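(* Let $A=(\mathbf{a}_1,\ldots,\mathbf{a}_n)\in\mathbb{R}^{m\times n}$, $m\ge n$, have full column rank, and let $Q\in\mathbb{R}^{m\times n}$ and upper triangular $R=(r_{ij})\in\mathbb{R}^{n\times n}$ be computed by the classical Gram–Schmidt algorithm with reorthogonalization (CGS2) in floating point arithmetic with machine unit $\varepsilon_M$ (see context). Then $$\|A-QR\|_2\le\varepsilon_M\left(2mn^{1/2}+2n^2+13n^{1/2}\right)\|A\|_2+\mathcal{O}(\varepsilon_M^2).$$ Moreover, let $\alpha=\sqrt{7+4\sqrt2}$, $\gamma_k=(\alpha^2(k-1)+1)^{-1/2}$, $L_F(m,k,1)=m+k^{1/2}(m+k)+4$, $f_1(m,k,1)=\gamma_k^{-1}L_F(m,k,1)$, and $$f_{sing}(m,k,1)=\left[(\alpha^2(k-1)+1)^{1/2}+1\right]\left(m+k^{1/2}(m+k)+4\right)+2.$$ If either $$\varepsilon_Mf_{sing}(m,k,1)\|\mathbf{a}_k\|_2\le\gamma_k|r_{kk}|,\qquad k=2,\ldots,n,$$ or $$|r_{kk}^{(2)}|\ge(1+\gamma_k^2)^{-1/2},\qquad k=2,\ldots,n,$$ where $r_{kk}^{(2)}$ is the diagonal element produced by the second Gram–Schmidt step at step $k$, then $$\|I_n-Q^TQ\|_2\le\varepsilon_Mf_1(m,n,1)+\mathcal{O}(\varepsilon_M^2).$$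
   Context: $\mathcal{O}(\varepsilon_M^j)$ denotes a quantity bounded by $C\varepsilon_M^j$ for all sufficiently small $\varepsilon_M>0$, with $C$ independent of $\varepsilon_M$ (it may depend on the dimensions and the input). Normalization of $\mathbf{y}\in\mathbb{R}^m$: $r=\|\mathbf{y}\|_2$, $\mathbf{q}=\mathbf{y}/r$. The computed values satisfy $r=\|\mathbf{y}\|_2(1+\delta)$, $|\delta|\le(m/2+1)\varepsilon_M+\mathcal{O}(\varepsilon_M^2)$, and $\mathbf{q}=(I_m+D)\mathbf{y}/r$ with $D$ diagonal, $\|D\|_2\le\varepsilon_M$. cgs2_step$(U,\mathbf{b})$ for $U\in\mathbb{R}^{m\times k}$, $\mathbf{b}\in\mathbb{R}^m$: $\mathbf{s}_1=U^T\mathbf{b}$; $\mathbf{y}_1=\mathbf{b}-U\mathbf{s}_1$; normalize $\mathbf{y}_1$ to get $r_1,\mathbf{q}_1$; $\mathbf{s}_2=U^T\mathbf{q}_1$; $\mathbf{y}_2=\mathbf{q}_1-U\mathbf{s}_2$; normalize $\mathbf{y}_2$ to get $r_2,\mathbf{q}_b$; $\mathbf{s}_b=\mathbf{s}_1+\mathbf{s}_2r_1$; $r_b=r_2r_1$; return $\mathbf{q}_b,r_b,\mathbf{s}_b$. Rounding error bounds: for each of the two half-steps applied to a vector $\mathbf{c}$ ($\mathbf{c}=\mathbf{b}$ or $\mathbf{c}=\mathbf{q}_1$), the computed $\bar{\mathbf{s}},\bar{\mathbf{y}}$ satisfy $\bar{\mathbf{s}}+\delta\bar{\mathbf{s}}=U^T\mathbf{c}$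 with $\|\delta\bar{\mathbf{s}}\|_2\le\varepsilon_Mmk^{1/2}\|\mathbf{c}\|_2+\mathcal{O}(\varepsilon_M^2)$ and $\bar{\mathbf{y}}+\delta\bar{\mathbf{y}}=\mathbf{c}-U\bar{\mathbf{s}}$ with $\|\delta\bar{\mathbf{y}}\|_2\le\varepsilon_M(1+k^{3/2})\|\mathbf{c}\|_2+\mathcal{O}(\varepsilon_M^2)$; and the computed $\mathbf{s}_b,r_b$ satisfy $\mathbf{s}_b+\delta\mathbf{s}_b=\mathbf{s}_1+\mathbf{s}_2r_1$, $\|\delta\mathbf{s}_b\|_2\le2\varepsilon_M\|\mathbf{b}\|_2+\mathcal{O}(\varepsilon_M^2)$, and $r_b+\delta r_b=r_2r_1$, $|\delta r_b|\le\varepsilon_M\|\mathbf{b}\|_2+\mathcal{O}(\varepsilon_M^2)$. These bounds hold whenever $\|I_k-U^TU\|_2\le\varepsilon_Mf_1(m,k,1)+\mathcal{O}(\varepsilon_M^2)<1$. CGS2: normalize $\mathbf{a}_1$ to get $R=(r_{11})$ and $Q=(\mathbf{q}_1)$; for $k=2,\ldots,n$, compute $[\mathbf{q}_{new},r_{new},\mathbf{s}_{new}]=\mathrm{cgs2\_step}(Q,\mathbf{a}_k)$ and update $R\leftarrow\begin{pmatrix}R&\mathbf{s}_{new}\\0&r_{new}\end{pmatrix}$, $Q\leftarrow(Q,\mathbf{q}_{new})$. The number $r_{kk}^{(2)}$ is the $r_2$ computed inside the $k$-th step. Standing assumptions: $\varepsilon_M f_1(m,n,1)<1$; and, for the residual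 bound, each matrix $U$ with $k$ columns ($1\le k\le n-1$) passed to cgs2_step satisfies $\|I_k-U^TU\|_2\le\varepsilon_Mf_1(m,k,1)+\mathcal{O}(\varepsilon_M^2)<1$. *)

theory Defs
  imports
    "HOL-Analysis.L2_Norm"
    "HOL-Library.Landau_Symbols"
    "Jordan_Normal_Form.DL_Rank"
begin

definition norm2 :: "real vec \<Rightarrow> real" where
  "norm2 v = L2_set (\<lambda>i. v $ i) {..<dim_vec v}"

definition spec_norm :: "real mat \<Rightarrow> real" where
  "spec_norm M = (SUP v \<in> {v \<in> carrier_vec (dim_col M). norm2 v \<le> 1}. norm2 (M *\<^sub>v v))"

text \<open>
  The third argument of \<open>L\<^sub>F(m,k,1)\<close>, \<open>f\<^sub>1(m,k,1)\<close> and \<open>f\<^sub>s\<^sub>i\<^sub>n\<^sub>g(m,k,1)\<close>, a block size that is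
  always 1 here, is dropped. Indices \<open>k\<close> start at 1.
\<close>

definition \<alpha>\<^sub>C :: real where
  "\<alpha>\<^sub>C = sqrt (7 + 4 * sqrt 2)"

definition \<gamma>\<^sub>C :: "nat \<Rightarrow> real" where
  "\<gamma>\<^sub>C k = 1 / sqrt (\<alpha>\<^sub>C\<^sup>2 * (real k - 1) + 1)"

definition L\<^sub>F :: "nat \<Rightarrow> nat \<Rightarrow> real" where
  "L\<^sub>F m k = real m + sqrt (real k) * (real m + real k) + 4"

definition f\<^sub>1 :: "nat \<Rightarrow> nat \<Rightarrow> real" where
  "f\<^sub>1 m k = inverse (\<gamma>\<^sub>C k) * L\<^sub>F m k"

definition f_sing :: "nat \<Rightarrow> nat \<Rightarrow> real" where
  "f_sing m k = (sqrt (\<alpha>\<^sub>C\<^sup>2 * (real k - 1) + 1) + 1)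
     * (real m + sqrt (real k) * (real m + real k) + 4) + 2"

text \<open>
  A computation is modelled as a family indexed by the machine unit \<open>\<epsilon>\<close>, and "for all sufficiently
  small \<open>\<epsilon> > 0\<close>" is the filter \<open>at_right 0\<close>. The predicates up to \<open>cgs2_skeleton\<close> speak about one
  fixed \<open>\<epsilon>\<close>; in them \<open>\<omega>\<close> is the value at \<open>\<epsilon>\<close> of the \<open>O(\<epsilon>\<^sup>2)\<close> term. One \<open>\<omega>\<close> may serve several
  bounds, because finitely many \<open>O(\<epsilon>\<^sup>2)\<close> terms have a common \<open>O(\<epsilon>\<^sup>2)\<close> majorant.
\<close>

abbreviation O_sq :: "(real \<Rightarrow> real) set" where
  "O_sq \<equiv> O[at_right 0](\<lambda>\<epsilon>. \<epsilon> ^ 2)"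

text \<open>
  Here \<open>y / r\<close> is the quotient by the computed \<open>r\<close>. A breakdown \<open>r = 0\<close> is not excluded: it gives
  \<open>q = 0\<close> by the convention \<open>1 / 0 = 0\<close>.
\<close>

definition normalized :: "real \<Rightarrow> real \<Rightarrow> real vec \<Rightarrow> real \<Rightarrow> real vec \<Rightarrow> bool" where
  "normalized \<epsilon> \<omega> y r q \<longleftrightarrow>
     (let m = dim_vec y in
      (\<exists>\<delta>. r = norm2 y * (1 + \<delta>) \<and> \<bar>\<delta>\<bar> \<le> (real m / 2 + 1) * \<epsilon> + \<omega>) \<and>
      (\<exists>D \<in> carrier_mat m m. diagonal_mat D \<and> spec_norm D \<le> \<epsilon> \<and>
         q = (1 / r) \<cdot>\<^sub>v ((1\<^sub>m m + D) *\<^sub>v y)))"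

definition half_step_bounds ::
  "real \<Rightarrow> real \<Rightarrow> real mat \<Rightarrow> real vec \<Rightarrow> real vec \<Rightarrow> real vec \<Rightarrow> bool" where
  "half_step_bounds \<epsilon> \<omega> U c s y \<longleftrightarrow>
     (let m = dim_row U; k = dim_col U in
      (\<exists>\<delta>s \<in> carrier_vec k. s + \<delta>s = transpose_mat U *\<^sub>v c \<and>
         norm2 \<delta>s \<le> \<epsilon> * real m * sqrt (real k) * norm2 c + \<omega>) \<and>
      (\<exists>\<delta>y \<in> carrier_vec m. y + \<delta>y = c - U *\<^sub>v s \<and>
         norm2 \<delta>y \<le> \<epsilon> * (1 + real k powr (3 / 2)) * norm2 c + \<omega>))"

record cgs2_vals =
  val_s1 :: "real vec"
  val_y1 :: "real vec"
  val_r1 :: real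
  val_q1 :: "real vec"
  val_s2 :: "real vec"
  val_y2 :: "real vec"
  val_r2 :: real
  val_qb :: "real vec"
  val_rb :: real
  val_sb :: "real vec"

definition vals_shape :: "nat \<Rightarrow> nat \<Rightarrow> cgs2_vals \<Rightarrow> bool" where
  "vals_shape m k v \<longleftrightarrow>
     val_s1 v \<in> carrier_vec k \<and> val_s2 v \<in> carrier_vec k \<and> val_sb v \<in> carrier_vec k \<and>
     val_y1 v \<in> carrier_vec m \<and> val_q1 v \<in> carrier_vec m \<and>
     val_y2 v \<in> carrier_vec m \<and> val_qb v \<in> carrier_vec m"

definition step_normalized :: "real \<Rightarrow> real \<Rightarrow> cgs2_vals \<Rightarrow> bool" where
  "step_normalized \<epsilon> \<omega> v \<longleftrightarrow>
     normalized \<epsilon> \<omega> (val_y1 v) (val_r1 v) (val_q1 v) \<and>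
     normalized \<epsilon> \<omega> (val_y2 v) (val_r2 v) (val_qb v)"

definition step_bounds :: "real \<Rightarrow> real \<Rightarrow> real mat \<Rightarrow> real vec \<Rightarrow> cgs2_vals \<Rightarrow> bool" where
  "step_bounds \<epsilon> \<omega> U b v \<longleftrightarrow>
     half_step_bounds \<epsilon> \<omega> U b (val_s1 v) (val_y1 v) \<and>
     half_step_bounds \<epsilon> \<omega> U (val_q1 v) (val_s2 v) (val_y2 v) \<and>
     (\<exists>\<delta>s \<in> carrier_vec (dim_col U).
        val_sb v + \<delta>s = val_s1 v + val_r1 v \<cdot>\<^sub>v val_s2 v \<and> norm2 \<delta>s \<le> 2 * \<epsilon> * norm2 b + \<omega>) \<and>
     (\<exists>\<delta>r. val_rb v + \<delta>r = val_r2 v * val_r1 v \<and> \<bar>\<delta>r\<bar> \<le> \<epsilon> * norm2 b + \<omega>)"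

definition near_orthonormal :: "real \<Rightarrow> real \<Rightarrow> real mat \<Rightarrow> bool" where
  "near_orthonormal \<epsilon> \<omega> U \<longleftrightarrow>
     (let m = dim_row U; k = dim_col U in
      spec_norm (1\<^sub>m k - transpose_mat U * U) \<le> \<epsilon> * f\<^sub>1 m k + \<omega> \<and> \<epsilon> * f\<^sub>1 m k + \<omega> < 1)"

definition first_cols :: "nat \<Rightarrow> real mat \<Rightarrow> real mat" where
  "first_cols k Q = mat (dim_row Q) k (\<lambda>(i, j). Q $$ (i, j))"

text \<open>
  \<open>v k\<close> holds the values computed in the call \<open>cgs2_step(first_cols (k - 1) Q, a\<^sub>k)\<close>, for
  \<open>k = 2, \<dots>, n\<close>. Rows and columns of library matrices are counted from 0, so column \<open>k\<close> of the
  text has index \<open>k - 1\<close>.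
\<close>

definition cgs2_skeleton ::
  "nat \<Rightarrow> nat \<Rightarrow> real mat \<Rightarrow> real mat \<Rightarrow> (nat \<Rightarrow> cgs2_vals) \<Rightarrow> bool" where
  "cgs2_skeleton m n Q R v \<longleftrightarrow>
     Q \<in> carrier_mat m n \<and> R \<in> carrier_mat n n \<and> upper_triangular R \<and>
     (\<forall>k \<in> {2..n}. vals_shape m (k - 1) (v k) \<and>
        col Q (k - 1) = val_qb (v k) \<and>
        R $$ (k - 1, k - 1) = val_rb (v k) \<and>
        (\<forall>i < k - 1. R $$ (i, k - 1) = val_sb (v k) $ i))"

text \<open>
  The error bounds of a step are only available while its input \<open>U\<close> is nearly orthonormal, whatever
  the \<open>O(\<epsilon>\<^sup>2)\<close> term \<open>\<eta>\<close> in that hypothesis; the \<open>O(\<epsilon>\<^sup>2)\<close> term \<open>\<omega>\<close> of the bounds may depend on \<open>\<eta>\<close>.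
\<close>

definition cgs2_computes ::
  "nat \<Rightarrow> nat \<Rightarrow> real mat \<Rightarrow> (real \<Rightarrow> real mat) \<Rightarrow> (real \<Rightarrow> real mat)
     \<Rightarrow> (real \<Rightarrow> nat \<Rightarrow> cgs2_vals) \<Rightarrow> bool" where
  "cgs2_computes m n A Q R v \<longleftrightarrow>
     (\<forall>\<^sub>F \<epsilon> in at_right 0. cgs2_skeleton m n (Q \<epsilon>) (R \<epsilon>) (v \<epsilon>)) \<and>
     (\<exists>\<omega> \<in> O_sq. \<forall>\<^sub>F \<epsilon> in at_right 0.
        normalized \<epsilon> (\<omega> \<epsilon>) (col A 0) (R \<epsilon> $$ (0, 0)) (col (Q \<epsilon>) 0) \<and>
        (\<forall>k \<in> {2..n}. step_normalized \<epsilon> (\<omega> \<epsilon>) (v \<epsilon> k))) \<and>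
     (\<forall>k \<in> {2..n}. \<forall>\<eta> \<in> O_sq. \<exists>\<omega> \<in> O_sq. \<forall>\<^sub>F \<epsilon> in at_right 0.
        near_orthonormal \<epsilon> (\<eta> \<epsilon>) (first_cols (k - 1) (Q \<epsilon>)) \<longrightarrow>
        step_bounds \<epsilon> (\<omega> \<epsilon>) (first_cols (k - 1) (Q \<epsilon>)) (col A (k - 1)) (v \<epsilon> k))"

end

theory Submission
  imports Defs
begin

text \<open>
  All the claimed constants leave room to spare, so for each of the finitely many steps one can fix a
  tolerance \<open>\<tau> > 0\<close> and work with \<open>\<epsilon>\<close> so small that every error term is at most \<open>\<tau>\<close> and every
  \<open>O(\<epsilon>\<^sup>2)\<close> term at most \<open>\<tau> \<epsilon>\<close>; both bounds then hold with remainder \<open>0\<close>.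

  Residual: adding up the backward errors of one step bounds column \<open>k\<close> of \<open>A - Q R\<close> by a multiple of
  \<open>\<epsilon> \<parallel>a\<^sub>k\<parallel>\<close>, and a matrix with \<open>n\<close> columns has spectral norm at most \<open>\<surd>n\<close> times its largest column.

  Orthogonality is an induction on the number of columns. With \<open>U\<close> the matrix of the columns computed
  so far and \<open>t = \<parallel>U\<^sup>T q\<^sub>1\<parallel>\<close>, near-Pythagoras gives \<open>t\<^sup>2 + r\<^sub>2\<^sup>2 \<approx> 1\<close>. A large \<open>r\<^sub>k\<^sub>k = r\<^sub>2 r\<^sub>1\<close> forces
  \<open>t \<le> \<gamma>\<^sub>k r\<^sub>2\<close> because \<open>r\<^sub>1 t\<close> is \<open>O(\<epsilon> \<parallel>a\<^sub>k\<parallel>)\<close>, and a large \<open>r\<^sub>2\<close> forces \<open>t \<le> \<gamma>\<^bsub>k-1\<^esub> r\<^sub>2\<close> by near-Pythagoras.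
  The second projection multiplies the defect \<open>\<epsilon> f\<^sub>1(m,k-1)\<close> by \<open>t / r\<^sub>2\<close>, which leaves
  \<open>\<epsilon> L\<^sub>F(m,k-1)\<close>; with the rounding errors the new column satisfies
  \<open>\<parallel>U\<^sup>T q\<parallel> \<le> \<epsilon> (1 + \<surd>2) L\<^sub>F(m,k)\<close>. The squared defect thus grows by at most
  \<open>(2 (1 + \<surd>2)\<^sup>2 + 1) \<epsilon>\<^sup>2 L\<^sub>F(m,k)\<^sup>2\<close>, and \<open>2 (1 + \<surd>2)\<^sup>2 + 1 = 7 + 4 \<surd>2 = \<alpha>\<^sup>2\<close>.
\<close>

section \<open>Euclidean and spectral norm\<close>

lemma norm2_nonneg [simp]: "0 \<le> norm2 v"
  by (simp add: norm2_def)

lemma norm2_sq: "(norm2 v)\<^sup>2 = v \<bullet> v"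
  by (simp add: norm2_def L2_set_def scalar_prod_def sum_nonneg power2_eq_square atLeast0LessThan)

lemma norm2_smult: "norm2 (c \<cdot>\<^sub>v v) = \<bar>c\<bar> * norm2 v"
proof -
  have "norm2 (c \<cdot>\<^sub>v v) = L2_set (\<lambda>i. \<bar>c\<bar> * v $ i) {..<dim_vec v}"
    by (simp add: norm2_def L2_set_def power_mult_distrib)
  then show ?thesis
    by (simp add: norm2_def L2_set_right_distrib)
qed

lemma norm2_zero [simp]: "norm2 (0\<^sub>v k) = 0"
  by (simp add: norm2_def L2_set_def)

lemma norm2_eq_0_iff: "norm2 v = 0 \<longleftrightarrow> v = 0\<^sub>v (dim_vec v)"
proof -
  have "norm2 v = 0 \<longleftrightarrow> (\<forall>i < dim_vec v. v $ i = 0)"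
    by (auto simp: norm2_def L2_set_eq_0_iff)
  also have "\<dots> \<longleftrightarrow> v = 0\<^sub>v (dim_vec v)"
    by (auto simp: vec_eq_iff)
  finally show ?thesis .
qed

lemma norm2_add_le:
  assumes "v \<in> carrier_vec k" "w \<in> carrier_vec k"
  shows "norm2 (v + w) \<le> norm2 v + norm2 w"
proof -
  have "norm2 (v + w) = L2_set (\<lambda>i. v $ i + w $ i) {..<k}"
    using assms by (auto simp: norm2_def intro!: L2_set_cong)
  also have "\<dots> \<le> norm2 v + norm2 w"
    using assms L2_set_triangle_ineq[of "\<lambda>i. v $ i" "\<lambda>i. w $ i" "{..<k}"]
    by (simp add: norm2_def)
  finally show ?thesis .
qed

lemma norm2_uminus [simp]: "norm2 (- v) = norm2 (v :: real vec)"
  by (simp add: norm2_def L2_set_def)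

lemma norm2_diff_le:
  assumes "v \<in> carrier_vec k" "w \<in> carrier_vec k"
  shows "norm2 (v - w) \<le> norm2 v + norm2 w"
proof -
  have "v - w = v + (- w)"
    using assms by auto
  then show ?thesis
    using norm2_add_le[of v k "- w"] assms by simp
qed

lemma abs_norm2_diff_le:
  assumes "v \<in> carrier_vec k" "w \<in> carrier_vec k"
  shows "\<bar>norm2 (v + w) - norm2 v\<bar> \<le> norm2 w"
proof -
  have "v = (v + w) - w"
    using assms by auto
  then have "norm2 v \<le> norm2 (v + w) + norm2 w"
    using norm2_diff_le[of "v + w" k w] assms by simp
  with norm2_add_le[OF assms] show ?thesis
    by linarith
qed

lemma abs_scalar_prod_le:
  assumes "v \<in> carrier_vec k" "w \<in> carrier_vec k"
  shows "\<bar>v \<bullet> w\<bar> \<le> norm2 v * norm2 w"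
proof -
  have "\<bar>v \<bullet> w\<bar> \<le> (\<Sum>i<k. \<bar>v $ i\<bar> * \<bar>w $ i\<bar>)"
    using assms by (simp add: scalar_prod_def atLeast0LessThan flip: abs_mult)
  also have "\<dots> \<le> norm2 v * norm2 w"
    using assms L2_set_mult_ineq[of "\<lambda>i. v $ i" "\<lambda>i. w $ i" "{..<k}"] by (simp add: norm2_def)
  finally show ?thesis .
qed

section \<open>The spectral norm as a supremum\<close>

text \<open>A real \<open>SUP\<close> is only meaningful for a bounded set. Cauchy-Schwarz in each
  row gives the crude bound by the sum of the row norms, which is enough for this purpose.\<close>

lemma bdd_above_norm2_mult:
  "bdd_above ((\<lambda>v. norm2 (M *\<^sub>v v)) ` {v \<in> carrier_vec (dim_col M). norm2 v \<le> 1})"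
proof (rule bdd_aboveI2)
  fix v assume v: "v \<in> {v \<in> carrier_vec (dim_col M). norm2 v \<le> 1}"
  have "norm2 (M *\<^sub>v v) \<le> (\<Sum>i<dim_row M. \<bar>(M *\<^sub>v v) $ i\<bar>)"
    unfolding norm2_def dim_mult_mat_vec by (rule L2_set_le_sum_abs)
  also have "\<dots> \<le> (\<Sum>i<dim_row M. norm2 (row M i))"
  proof (rule sum_mono)
    fix i assume "i \<in> {..<dim_row M}"
    then have "\<bar>(M *\<^sub>v v) $ i\<bar> \<le> norm2 (row M i) * norm2 v"
      using v abs_scalar_prod_le[of "row M i" "dim_col M" v] by simp
    also have "\<dots> \<le> norm2 (row M i)"
      using v by (simp add: mult_left_le)
    finally show "\<bar>(M *\<^sub>v v) $ i\<bar> \<le> norm2 (row M i)" .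
  qed
  finally show "norm2 (M *\<^sub>v v) \<le> (\<Sum>i<dim_row M. norm2 (row M i))" .
qed

lemma spec_norm_leI:
  assumes "\<And>v. v \<in> carrier_vec (dim_col M) \<Longrightarrow> norm2 v \<le> 1 \<Longrightarrow> norm2 (M *\<^sub>v v) \<le> c"
  shows "spec_norm M \<le> c"
  unfolding spec_norm_def
proof (rule cSUP_least)
  have "0\<^sub>v (dim_col M) \<in> {v \<in> carrier_vec (dim_col M). norm2 v \<le> 1}"
    by simp
  then show "{v \<in> carrier_vec (dim_col M). norm2 v \<le> 1} \<noteq> {}"
    by blast
qed (use assms in auto)

text \<open>Homogeneity passes from the unit ball to all vectors by scaling \<open>v\<close> to norm
  1; only \<open>v = 0\<close> has to be treated apart.\<close>

lemma norm2_mult_le_spec_norm: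
  assumes "v \<in> carrier_vec (dim_col M)"
  shows "norm2 (M *\<^sub>v v) \<le> spec_norm M * norm2 v"
proof (cases "norm2 v = 0")
  case True
  then have "v = 0\<^sub>v (dim_col M)"
    using assms by (simp add: norm2_eq_0_iff)
  then have "M *\<^sub>v v = 0\<^sub>v (dim_row M)"
    by auto
  with True show ?thesis
    by simp
next
  case False
  then have pos: "norm2 v > 0"
    by (simp add: less_le)
  define u where "u = (1 / norm2 v) \<cdot>\<^sub>v v"
  have u: "u \<in> carrier_vec (dim_col M)" "norm2 u = 1"
    using assms pos by (auto simp: u_def norm2_smult)
  have "norm2 (M *\<^sub>v u) \<le> spec_norm M"
    unfolding spec_norm_def using u by (intro cSUP_upper bdd_above_norm2_mult) auto
  moreover have "M *\<^sub>v u = (1 / norm2 v) \<cdot>\<^sub>v (M *\<^sub>v v)"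
    unfolding u_def using assms by (intro mult_mat_vec) auto
  ultimately show ?thesis
    using pos by (simp add: norm2_smult field_simps)
qed

lemma spec_norm_nonneg: "0 \<le> spec_norm M"
proof -
  have "norm2 (M *\<^sub>v 0\<^sub>v (dim_col M)) \<le> spec_norm M"
    unfolding spec_norm_def by (intro cSUP_upper bdd_above_norm2_mult) auto
  then show ?thesis
    using norm2_nonneg order_trans by blast
qed

lemma norm2_col_le_spec_norm:
  assumes "j < dim_col M"
  shows "norm2 (col M j) \<le> spec_norm M"
proof -
  have "M *\<^sub>v unit_vec (dim_col M) j = col M j"
    using assms by (intro eq_vecI) auto
  moreover have "norm2 (unit_vec (dim_col M) j) = 1"
    using assms norm2_sq[of "unit_vec (dim_col M) j"]
    by (metis norm2_nonneg index_unit_vec(2) power2_eq_1_iff scalar_prod_right_unit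
        index_unit_vec(1) unit_vec_carrier le_minus_one_simps(3))
  ultimately show ?thesis
    using norm2_mult_le_spec_norm[of "unit_vec (dim_col M) j" M] by simp
qed

text \<open>\<open>M *\<^sub>v v\<close> is the combination of the columns with coefficients
  \<open>v $ j\<close>. The triangle inequality, applied to partial sums, bounds it by c times the
  sum of the absolute values of these coefficients, and Cauchy-Schwarz against a constant turns that
  sum into the square root of the number of columns.\<close>

lemma spec_norm_le_sqrt_mult:
  assumes "\<And>j. j < dim_col M \<Longrightarrow> norm2 (col M j) \<le> c" and "0 \<le> c"
  shows "spec_norm M \<le> sqrt (dim_col M) * c"
proof (rule spec_norm_leI)
  fix v assume v: "v \<in> carrier_vec (dim_col M)" "norm2 v \<le> 1"
  define n where "n = dim_col M"
  have partial: "norm2 (vec (dim_row M) (\<lambda>i. \<Sum>j<k. M $$ (i, j) * v $ j)) \<le> (\<Sum>j<k. \<bar>v $ j\<bar> * c)"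
    if "k \<le> n" for k
    using that
  proof (induction k)
    case 0
    then show ?case
      by (simp add: norm2_def L2_set_def)
  next
    case (Suc k)
    have "vec (dim_row M) (\<lambda>i. \<Sum>j<Suc k. M $$ (i, j) * v $ j) =
        vec (dim_row M) (\<lambda>i. \<Sum>j<k. M $$ (i, j) * v $ j) + v $ k \<cdot>\<^sub>v col M k"
      using Suc.prems by (intro eq_vecI) (auto simp: n_def)
    then have "norm2 (vec (dim_row M) (\<lambda>i. \<Sum>j<Suc k. M $$ (i, j) * v $ j)) \<le>
        norm2 (vec (dim_row M) (\<lambda>i. \<Sum>j<k. M $$ (i, j) * v $ j)) + norm2 (v $ k \<cdot>\<^sub>v col M k)"
      by (simp only:) (rule norm2_add_le[of _ "dim_row M"], auto)
    moreover have "norm2 (v $ k \<cdot>\<^sub>v col M k) \<le> \<bar>v $ k\<bar> * c"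
      using Suc.prems assms(1)[of k] by (simp add: norm2_smult n_def mult_left_mono)
    ultimately show ?case
      using Suc by simp
  qed
  have "M *\<^sub>v v = vec (dim_row M) (\<lambda>i. \<Sum>j<n. M $$ (i, j) * v $ j)"
    using v by (intro eq_vecI) (auto simp: scalar_prod_def n_def atLeast0LessThan)
  then have "norm2 (M *\<^sub>v v) \<le> (\<Sum>j<n. \<bar>v $ j\<bar> * c)"
    using partial[of n] by simp
  also have "\<dots> \<le> norm2 v * (sqrt n * c)"
    using L2_set_mult_ineq[of "\<lambda>j. v $ j" "\<lambda>_. c" "{..<n}"] v assms(2)
    by (simp add: norm2_def n_def L2_set_constant)
  also have "\<dots> \<le> sqrt n * c"
    using v assms(2) by (intro mult_left_le_one_le) auto
  finally show "norm2 (M *\<^sub>v v) \<le> sqrt (dim_col M) * c"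
    by (simp add: n_def)
qed

text \<open>The rank is the size of a maximal independent set of columns, so full rank puts every
  column into an independent set, which cannot contain zero. Nonzero columns are what allows
  remainders to be measured relative to the norm of the column.\<close>

lemma full_rank_col_nonzero:
  fixes A :: "real mat"
  assumes A: "A \<in> carrier_mat m n" and rank: "vec_space.rank m A = n" and j: "j < n"
  shows "col A j \<noteq> 0\<^sub>v m"
proof -
  interpret vec_space "TYPE(real)" m .
  obtain S where S: "maximal S (\<lambda>T. T \<subseteq> set (cols A) \<and> lin_indpt T)"
    using maximal_exists[of "\<lambda>T. T \<subseteq> set (cols A) \<and> lin_indpt T" "card (set (cols A))" "{}"]
    by (meson List.finite_set card_mono empty_iff empty_subsetI finite_lin_indpt2 rev_finite_subset)
  then have "card S = n"
    using rank_card_indpt[OF A S] rank by simp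
  moreover have "S \<subseteq> set (cols A)" and indpt: "lin_indpt S"
    using S by (auto simp: maximal_def)
  moreover have "card (set (cols A)) \<le> n"
    using A card_length[of "cols A"] by simp
  \<comment> \<open>A subset with n elements of a set with at most n elements is the whole
    set.\<close>
  ultimately have eq: "S = set (cols A)"
    by (metis List.finite_set card_seteq)
  have "S \<subseteq> carrier_vec m"
    using \<open>S \<subseteq> set (cols A)\<close> cols_dim[of A] A by auto
  then have "0\<^sub>v m \<notin> S"
    using zero_nin_lin_indpt[OF _ indpt] class_semiring.one_zeroI by auto
  moreover have "col A j \<in> set (cols A)"
    using A j by (metis carrier_matD(2) cols_length cols_nth nth_mem)
  ultimately show ?thesis
    using eq by auto
qed

section \<open>Half-steps and normalization\<close>

lemma gram_defect_le:
  assumes U: "U \<in> carrier_mat m k"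
    and e: "spec_norm (1\<^sub>m k - transpose_mat U * U) \<le> e"
    and x: "x \<in> carrier_vec k"
  shows "norm2 (x - transpose_mat U *\<^sub>v (U *\<^sub>v x)) \<le> e * norm2 x"
proof -
  have "(1\<^sub>m k - transpose_mat U * U) *\<^sub>v x = x - (transpose_mat U * U) *\<^sub>v x"
    using U x by (subst minus_mult_distrib_mat_vec) auto
  also have "(transpose_mat U * U) *\<^sub>v x = transpose_mat U *\<^sub>v (U *\<^sub>v x)"
    using U x by (intro assoc_mult_mat_vec) auto
  finally have "norm2 (x - transpose_mat U *\<^sub>v (U *\<^sub>v x)) \<le>
      spec_norm (1\<^sub>m k - transpose_mat U * U) * norm2 x"
    using norm2_mult_le_spec_norm[of x "1\<^sub>m k - transpose_mat U * U"] U x by simp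
  also have "\<dots> \<le> e * norm2 x"
    using e by (intro mult_right_mono) auto
  finally show ?thesis .
qed

text \<open>The difference of the squared norms is the scalar product of \<open>x\<close> with the
  defect vector x - U^T U x, to which Cauchy-Schwarz applies.\<close>

lemma near_isometry:
  assumes U: "U \<in> carrier_mat m k"
    and e: "spec_norm (1\<^sub>m k - transpose_mat U * U) \<le> e"
    and x: "x \<in> carrier_vec k"
  shows "\<bar>(norm2 (U *\<^sub>v x))\<^sup>2 - (norm2 x)\<^sup>2\<bar> \<le> e * (norm2 x)\<^sup>2"
proof -
  have "(norm2 x)\<^sup>2 - (norm2 (U *\<^sub>v x))\<^sup>2 = x \<bullet> x - x \<bullet> (transpose_mat U *\<^sub>v (U *\<^sub>v x))"
    using transpose_vec_mult_scalar[OF U x mult_mat_vec_carrier[OF U x]] U x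
    by (simp add: norm2_sq comm_scalar_prod[of x k "transpose_mat U *\<^sub>v (U *\<^sub>v x)"])
  also have "\<dots> = x \<bullet> (x - transpose_mat U *\<^sub>v (U *\<^sub>v x))"
    using U x by (subst scalar_prod_minus_distrib) auto
  finally have "\<bar>(norm2 x)\<^sup>2 - (norm2 (U *\<^sub>v x))\<^sup>2\<bar> \<le>
      norm2 x * norm2 (x - transpose_mat U *\<^sub>v (U *\<^sub>v x))"
    using abs_scalar_prod_le[of x k "x - transpose_mat U *\<^sub>v (U *\<^sub>v x)"] U x by simp
  also have "\<dots> \<le> norm2 x * (e * norm2 x)"
    by (intro mult_left_mono gram_defect_le[OF U e x]) simp
  finally show ?thesis
    by (simp add: power2_eq_square algebra_simps abs_minus_commute)
qed

text \<open>The square root of 1 + e is replaced by the larger 1 + e to keep later estimates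
  polynomial in e.\<close>

lemma norm2_near_isometry_le:
  assumes U: "U \<in> carrier_mat m k"
    and e: "spec_norm (1\<^sub>m k - transpose_mat U * U) \<le> e"
    and x: "x \<in> carrier_vec k"
  shows "norm2 (U *\<^sub>v x) \<le> (1 + e) * norm2 x"
proof -
  have e0: "0 \<le> e"
    using e spec_norm_nonneg order_trans by blast
  have "(norm2 (U *\<^sub>v x))\<^sup>2 \<le> (1 + e) * (norm2 x)\<^sup>2"
    using near_isometry[OF assms] by (simp add: algebra_simps)
  also have "\<dots> \<le> ((1 + e) * norm2 x)\<^sup>2"
    unfolding power_mult_distrib
    using e0 self_le_power[of "1 + e" 2] by (intro mult_right_mono) auto
  finally show ?thesis
    by (rule power2_le_imp_le) (use e0 in simp)
qed

text \<open>Duality: for w = U^T c the squared norm of w is the scalar product of c and U w, so the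
  bound for \<open>U\<close> carries over after cancelling one factor
  \<open>norm2 w\<close>.\<close>

lemma norm2_transpose_near_isometry_le:
  assumes U: "U \<in> carrier_mat m k"
    and e: "spec_norm (1\<^sub>m k - transpose_mat U * U) \<le> e"
    and c: "c \<in> carrier_vec m"
  shows "norm2 (transpose_mat U *\<^sub>v c) \<le> (1 + e) * norm2 c"
proof -
  define w where "w = transpose_mat U *\<^sub>v c"
  have w: "w \<in> carrier_vec k"
    using U c by (auto simp: w_def)
  have "(norm2 w)\<^sup>2 = c \<bullet> (U *\<^sub>v w)"
    using transpose_vec_mult_scalar[OF U w c] by (simp add: norm2_sq w_def)
  also have "\<dots> \<le> norm2 c * norm2 (U *\<^sub>v w)"
    using abs_scalar_prod_le[of c m "U *\<^sub>v w"] U c w by simp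
  also have "\<dots> \<le> norm2 c * ((1 + e) * norm2 w)"
    by (intro mult_left_mono norm2_near_isometry_le[OF U e w]) simp
  finally have "norm2 w * norm2 w \<le> ((1 + e) * norm2 c) * norm2 w"
    by (simp add: power2_eq_square algebra_simps)
  moreover have "0 \<le> (1 + e) * norm2 c"
    using e spec_norm_nonneg[of "1\<^sub>m k - transpose_mat U * U"] by auto
  ultimately have "norm2 w \<le> (1 + e) * norm2 c"
    using norm2_nonneg[of w] by (cases "norm2 w = 0") (auto simp: mult_le_cancel_right)
  then show ?thesis
    by (simp add: w_def)
qed

text \<open>Near-Pythagoras. Expanding the square is exact up to the term
  \<open>(norm2 (U *\<^sub>v w))\<^sup>2\<close>, which differs from
  \<open>(norm2 w)\<^sup>2\<close> by the defect of \<open>U\<close>.\<close>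

lemma projection_norm:
  assumes U: "U \<in> carrier_mat m k"
    and e: "spec_norm (1\<^sub>m k - transpose_mat U * U) \<le> e"
    and c: "c \<in> carrier_vec m"
  defines "w \<equiv> transpose_mat U *\<^sub>v c"
  shows "\<bar>(norm2 (c - U *\<^sub>v w))\<^sup>2 - ((norm2 c)\<^sup>2 - (norm2 w)\<^sup>2)\<bar> \<le> e * (norm2 w)\<^sup>2"
proof -
  have w: "w \<in> carrier_vec k"
    using U c by (auto simp: w_def)
  have Uw: "U *\<^sub>v w \<in> carrier_vec m"
    using U w by auto
  have "(norm2 (c - U *\<^sub>v w))\<^sup>2 = c \<bullet> c - c \<bullet> (U *\<^sub>v w) - (c \<bullet> (U *\<^sub>v w) - (norm2 (U *\<^sub>v w))\<^sup>2)"
    using c Uw comm_scalar_prod[OF c Uw]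
    by (simp add: norm2_sq minus_scalar_prod_distrib[of _ m] scalar_prod_minus_distrib[of _ m])
  moreover have "c \<bullet> (U *\<^sub>v w) = (norm2 w)\<^sup>2"
    using transpose_vec_mult_scalar[OF U w c] by (simp add: norm2_sq w_def)
  ultimately show ?thesis
    using near_isometry[OF U e w] by (simp add: norm2_sq[of c, symmetric])
qed

text \<open>This is the inductive step for orthogonality. The Gram defect of (U, q) has the blocks I
  - U^T U, -U^T q, its transpose, and 1 - q^T q. Its spectral norm is at most the Frobenius norm of
  the 2 by 2 matrix of the block bounds e, c, c, d.\<close>

lemma spec_norm_gram_defect_append:
  assumes U: "U \<in> carrier_mat m k" and Q: "Q \<in> carrier_mat m (Suc k)"
    and cols: "\<And>i j. i < m \<Longrightarrow> j < k \<Longrightarrow> Q $$ (i, j) = U $$ (i, j)"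
    and e: "spec_norm (1\<^sub>m k - transpose_mat U * U) \<le> e"
    and c: "norm2 (transpose_mat U *\<^sub>v col Q k) \<le> c"
    and d: "\<bar>1 - (norm2 (col Q k))\<^sup>2\<bar> \<le> d"
  shows "spec_norm (1\<^sub>m (Suc k) - transpose_mat Q * Q) \<le> sqrt (e\<^sup>2 + 2 * c\<^sup>2 + d\<^sup>2)"
proof (rule spec_norm_leI)
  define q where "q = col Q k"
  have q: "q \<in> carrier_vec m"
    using Q by (auto simp: q_def)
  fix x assume "x \<in> carrier_vec (dim_col (1\<^sub>m (Suc k) - transpose_mat Q * Q))" and x1: "norm2 x \<le> 1"
  then have x: "x \<in> carrier_vec (Suc k)"
    using Q by simp
  define w where "w = vec k (\<lambda>i. x $ i)"
  define z where "z = x $ k"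
  define p where "p = transpose_mat U *\<^sub>v q"
  have w: "w \<in> carrier_vec k" and p: "p \<in> carrier_vec k"
    using U q by (auto simp: w_def p_def)
  have norm_split: "(norm2 u)\<^sup>2 = (norm2 (vec k (\<lambda>i. u $ i)))\<^sup>2 + (u $ k)\<^sup>2"
    if "u \<in> carrier_vec (Suc k)" for u :: "real vec"
    using that by (simp add: norm2_def L2_set_def sum_nonneg)
  have Qx: "Q *\<^sub>v x = U *\<^sub>v w + z \<cdot>\<^sub>v q"
    using Q U x by (intro eq_vecI)
      (auto simp: scalar_prod_def atLeast0LessThan cols w_def z_def q_def intro!: sum.cong)
  define g where "g = (1\<^sub>m (Suc k) - transpose_mat Q * Q) *\<^sub>v x"
  have "g = x - transpose_mat Q *\<^sub>v (Q *\<^sub>v x)"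
  proof -
    have "g = x - (transpose_mat Q * Q) *\<^sub>v x"
      unfolding g_def using Q x by (subst minus_mult_distrib_mat_vec) auto
    also have "(transpose_mat Q * Q) *\<^sub>v x = transpose_mat Q *\<^sub>v (Q *\<^sub>v x)"
      using Q x by (intro assoc_mult_mat_vec) auto
    finally show ?thesis .
  qed
  then have g_index: "g $ i = x $ i - col Q i \<bullet> (U *\<^sub>v w + z \<cdot>\<^sub>v q)" if "i < Suc k" for i
    using that Q x by (simp add: Qx)
  have g: "g \<in> carrier_vec (Suc k)"
    using Q by (intro carrier_vecI) (simp add: g_def)
  have Uw: "U *\<^sub>v w \<in> carrier_vec m"
    using U w by auto
  have upper: "vec k (\<lambda>i. g $ i) = (w - transpose_mat U *\<^sub>v (U *\<^sub>v w)) + (- z) \<cdot>\<^sub>v p"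
  proof (rule eq_vecI)
    fix i assume "i < dim_vec (w - transpose_mat U *\<^sub>v (U *\<^sub>v w) + (- z) \<cdot>\<^sub>v p)"
    then have i: "i < k"
      using p by simp
    have "col Q i = col U i"
      using Q U i cols by (intro eq_vecI) auto
    then have "g $ i = x $ i - (col U i \<bullet> (U *\<^sub>v w) + z * (col U i \<bullet> q))"
      using i U Uw q by (simp add: g_index scalar_prod_add_distrib[of _ m])
    then show "vec k (\<lambda>i. g $ i) $ i = (w - transpose_mat U *\<^sub>v (U *\<^sub>v w) + (- z) \<cdot>\<^sub>v p) $ i"
      using i U by (simp add: w_def p_def)
  qed (use p in auto)
  have lower: "g $ k = z * (1 - (norm2 q)\<^sup>2) - p \<bullet> w"
  proof -
    have "g $ k = z - (q \<bullet> (U *\<^sub>v w) + z * (q \<bullet> q))"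
      using Uw q by (simp add: g_index scalar_prod_add_distrib[of _ m] z_def flip: q_def)
    moreover have "q \<bullet> (U *\<^sub>v w) = p \<bullet> w"
      unfolding p_def using transpose_vec_mult_scalar[OF U w q] by simp
    ultimately show ?thesis
      by (simp add: norm2_sq algebra_simps)
  qed
  define W where "W = norm2 w"
  have pc: "norm2 p \<le> c"
    using c by (simp add: p_def q_def)
  have "norm2 (vec k (\<lambda>i. g $ i)) \<le> norm2 (w - transpose_mat U *\<^sub>v (U *\<^sub>v w)) + norm2 ((- z) \<cdot>\<^sub>v p)"
    unfolding upper using U w p by (intro norm2_add_le[of _ k]) auto
  also have "\<dots> \<le> e * W + c * \<bar>z\<bar>"
    unfolding norm2_smult W_def mult.commute[of "\<bar>- z\<bar>"]
    using pc by (intro add_mono gram_defect_le[OF U e w]) (simp add: mult_right_mono)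
  finally have 1: "(norm2 (vec k (\<lambda>i. g $ i)))\<^sup>2 \<le> (e * W + c * \<bar>z\<bar>)\<^sup>2"
    by (intro power_mono) auto
  have "\<bar>g $ k\<bar> \<le> \<bar>z\<bar> * d + c * W"
  proof -
    have "\<bar>p \<bullet> w\<bar> \<le> c * W"
      unfolding W_def using abs_scalar_prod_le[OF p w] mult_right_mono[OF pc norm2_nonneg[of w]]
      by linarith
    moreover have "\<bar>z * (1 - (norm2 q)\<^sup>2)\<bar> \<le> \<bar>z\<bar> * d"
      unfolding abs_mult using d by (intro mult_left_mono) (auto simp: q_def)
    ultimately show ?thesis
      unfolding lower by linarith
  qed
  then have "\<bar>g $ k\<bar>\<^sup>2 \<le> (\<bar>z\<bar> * d + c * W)\<^sup>2"
    by (intro power_mono) auto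
  then have 2: "(g $ k)\<^sup>2 \<le> (c * W + d * \<bar>z\<bar>)\<^sup>2"
    by (simp add: algebra_simps)
  \<comment> \<open>Cauchy-Schwarz in the plane through Lagrange's identity; it is used for the two
    rows (e, c) and (c, d) of block bounds.\<close>
  have cs: "(a * W + b * \<bar>z\<bar>)\<^sup>2 \<le> (a\<^sup>2 + b\<^sup>2) * (norm2 x)\<^sup>2" for a b
  proof -
    have "(a\<^sup>2 + b\<^sup>2) * (W\<^sup>2 + \<bar>z\<bar>\<^sup>2) - (a * W + b * \<bar>z\<bar>)\<^sup>2 = (a * \<bar>z\<bar> - b * W)\<^sup>2"
      by (simp add: power2_eq_square algebra_simps)
    moreover have "(norm2 x)\<^sup>2 = W\<^sup>2 + \<bar>z\<bar>\<^sup>2"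
      using norm_split[OF x] by (simp add: W_def w_def z_def)
    ultimately show ?thesis
      by (metis diff_ge_0_iff_ge zero_le_power2)
  qed
  have "(norm2 g)\<^sup>2 \<le> (e\<^sup>2 + c\<^sup>2) * (norm2 x)\<^sup>2 + (c\<^sup>2 + d\<^sup>2) * (norm2 x)\<^sup>2"
    unfolding norm_split[OF g] using 1 2 cs[of e c] cs[of c d] by linarith
  also have "\<dots> = (e\<^sup>2 + 2 * c\<^sup>2 + d\<^sup>2) * (norm2 x)\<^sup>2"
    by (simp add: algebra_simps)
  also have "\<dots> \<le> (e\<^sup>2 + 2 * c\<^sup>2 + d\<^sup>2) * 1"
    using x1 power_le_one[of "norm2 x" 2] by (intro mult_left_mono) auto
  finally show "norm2 ((1\<^sub>m (Suc k) - transpose_mat Q * Q) *\<^sub>v x) \<le> sqrt (e\<^sup>2 + 2 * c\<^sup>2 + d\<^sup>2)"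
    by (simp add: g_def[symmetric] real_le_rsqrt)
qed

section \<open>Rounding errors of a half-step\<close>

lemma nat_powr_three_halves: "real k powr (3 / 2) = real k * sqrt k"
  using powr_add[of "real k" 1 "1 / 2"] by (cases "k = 0") (auto simp: powr_half_sqrt)

text \<open>The computed \<open>y\<close> is the exact projection plus \<open>err\<close>, which
  collects both rounding errors. Multiplying by U^T, the exact part leaves only the defect of
  \<open>U\<close> acting on \<open>w\<close>, and the rest is of the size of
  \<open>err\<close>.\<close>

lemma half_step_estimates:
  assumes U: "U \<in> carrier_mat m k"
    and e: "spec_norm (1\<^sub>m k - transpose_mat U * U) \<le> e"
    and c: "c \<in> carrier_vec m" and s: "s \<in> carrier_vec k" and y: "y \<in> carrier_vec m"
    and bounds: "half_step_bounds \<epsilon> \<omega> U c s y"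
  defines "w \<equiv> transpose_mat U *\<^sub>v c"
  defines "h \<equiv> (1 + e) * (\<epsilon> * (sqrt k * (real m + real k) + 1) * norm2 c + 2 * \<omega>)"
  shows "\<bar>norm2 y - norm2 (c - U *\<^sub>v w)\<bar> \<le> h"
    and "norm2 (transpose_mat U *\<^sub>v y) \<le> e * norm2 w + (1 + e) * h"
proof -
  have e0: "0 \<le> e"
    using e spec_norm_nonneg order_trans by blast
  obtain \<delta>s \<delta>y where \<delta>s: "\<delta>s \<in> carrier_vec k" "s + \<delta>s = w"
      "norm2 \<delta>s \<le> \<epsilon> * real m * sqrt (real k) * norm2 c + \<omega>"
    and \<delta>y: "\<delta>y \<in> carrier_vec m" "y + \<delta>y = c - U *\<^sub>v s"
      "norm2 \<delta>y \<le> \<epsilon> * (1 + real k powr (3 / 2)) * norm2 c + \<omega>"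
    using bounds U unfolding half_step_bounds_def w_def Let_def by auto
  have w: "w \<in> carrier_vec k"
    using U c by (auto simp: w_def)
  define p where "p = c - U *\<^sub>v w"
  define err where "err = U *\<^sub>v \<delta>s - \<delta>y"
  have U\<delta>s: "U *\<^sub>v \<delta>s \<in> carrier_vec m"
    using U \<delta>s by auto
  have p: "p \<in> carrier_vec m" and err: "err \<in> carrier_vec m"
    using U c w \<delta>y U\<delta>s by (auto simp: p_def err_def)
  have Uw: "U *\<^sub>v w = U *\<^sub>v s + U *\<^sub>v \<delta>s"
    using U s \<delta>s by (simp flip: \<delta>s(2) add: mult_add_distrib_mat_vec)
  have y_eq: "y = p + err"
  proof (rule eq_vecI)
    fix i assume "i < dim_vec (p + err)"
    then have i: "i < m"
      using err by auto
    have "y $ i + \<delta>y $ i = c $ i - (U *\<^sub>v s) $ i"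
      using arg_cong[OF \<delta>y(2), of "\<lambda>x. x $ i"] i U c \<delta>y(1) y by simp
    moreover have "(p + err) $ i =
        c $ i - ((U *\<^sub>v s) $ i + (U *\<^sub>v \<delta>s) $ i) + ((U *\<^sub>v \<delta>s) $ i - \<delta>y $ i)"
      unfolding p_def err_def Uw using i U \<delta>y(1) by simp
    ultimately show "y $ i = (p + err) $ i"
      by linarith
  qed (use y err in auto)
  have "norm2 err \<le> norm2 (U *\<^sub>v \<delta>s) + norm2 \<delta>y"
    unfolding err_def by (rule norm2_diff_le[OF U\<delta>s \<delta>y(1)])
  also have "\<dots> \<le> (1 + e) * norm2 \<delta>s + (1 + e) * norm2 \<delta>y"
    using norm2_near_isometry_le[OF U e \<delta>s(1)] e0
      mult_right_mono[of 1 "1 + e" "norm2 \<delta>y"] by auto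
  also have "\<dots> \<le> (1 + e) * (\<epsilon> * real m * sqrt (real k) * norm2 c + \<omega>) +
      (1 + e) * (\<epsilon> * (1 + real k powr (3 / 2)) * norm2 c + \<omega>)"
    using e0 \<delta>s \<delta>y by (intro add_mono mult_left_mono) auto
  \<comment> \<open>The two error factors m k^(1/2) and 1 + k^(3/2) add up to k^(1/2) (m + k) +
    1.\<close>
  also have "\<dots> = h"
    by (simp add: h_def nat_powr_three_halves algebra_simps)
  finally have err_h: "norm2 err \<le> h" .
  then show "\<bar>norm2 y - norm2 (c - U *\<^sub>v w)\<bar> \<le> h"
    using abs_norm2_diff_le[OF p err] by (simp add: y_eq p_def)
  have "transpose_mat U *\<^sub>v p = w - transpose_mat U *\<^sub>v (U *\<^sub>v w)"
    unfolding p_def using U c w by (subst mult_minus_distrib_mat_vec) (auto simp: w_def)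
  then have Utp: "norm2 (transpose_mat U *\<^sub>v p) \<le> e * norm2 w"
    using gram_defect_le[OF U e w] by simp
  have "transpose_mat U *\<^sub>v y = transpose_mat U *\<^sub>v p + transpose_mat U *\<^sub>v err"
    unfolding y_eq using U p err by (subst mult_add_distrib_mat_vec) auto
  then have "norm2 (transpose_mat U *\<^sub>v y) \<le>
      norm2 (transpose_mat U *\<^sub>v p) + norm2 (transpose_mat U *\<^sub>v err)"
    using U p err by (simp only:) (rule norm2_add_le[of _ k], auto)
  also have "\<dots> \<le> e * norm2 w + (1 + e) * norm2 err"
    by (intro add_mono Utp norm2_transpose_near_isometry_le[OF U e err])
  also have "\<dots> \<le> e * norm2 w + (1 + e) * h"
    using e0 err_h by (intro add_mono mult_left_mono) auto
  finally show "norm2 (transpose_mat U *\<^sub>v y) \<le> e * norm2 w + (1 + e) * h" .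
qed

section \<open>Norms after normalization\<close>

text \<open>Multiplying out the division gives \<open>r \<cdot>\<^sub>v q = y + z\<close>, which
  survives a breakdown: since d < 1, the factor 1 + \<delta> is positive, so \<open>r = 0\<close>
  forces \<open>y\<close> and \<open>z\<close> to vanish.\<close>

lemma normalizedE:
  assumes "normalized \<epsilon> \<omega> y r q" and y: "y \<in> carrier_vec m"
    and d: "(real m / 2 + 1) * \<epsilon> + \<omega> \<le> d" "d < 1"
  obtains z where "z \<in> carrier_vec m" "norm2 z \<le> \<epsilon> * norm2 y" "r \<cdot>\<^sub>v q = y + z"
    "(1 - d) * norm2 y \<le> r" "r \<le> (1 + d) * norm2 y" "r = 0 \<Longrightarrow> norm2 q = 0"
proof -
  obtain \<delta> D where \<delta>: "r = norm2 y * (1 + \<delta>)" "\<bar>\<delta>\<bar> \<le> d"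
    and D: "D \<in> carrier_mat m m" "spec_norm D \<le> \<epsilon>" "q = (1 / r) \<cdot>\<^sub>v ((1\<^sub>m m + D) *\<^sub>v y)"
    using assms unfolding normalized_def Let_def by force
  define z where "z = D *\<^sub>v y"
  have z: "z \<in> carrier_vec m"
    using D y by (auto simp: z_def)
  have Dy: "(1\<^sub>m m + D) *\<^sub>v y = y + z"
    using D y by (subst add_mult_distrib_mat_vec) (auto simp: z_def)
  have "norm2 z \<le> spec_norm D * norm2 y"
    using norm2_mult_le_spec_norm[of y D] D y by (simp add: z_def)
  also have "\<dots> \<le> \<epsilon> * norm2 y"
    using D by (intro mult_right_mono) auto
  finally have z_le: "norm2 z \<le> \<epsilon> * norm2 y" .
  have lower: "(1 - d) * norm2 y \<le> r"
    using mult_right_mono[of "1 - d" "1 + \<delta>" "norm2 y"] \<delta> by (simp add: mult.commute)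
  have upper: "r \<le> (1 + d) * norm2 y"
    using mult_right_mono[of "1 + \<delta>" "1 + d" "norm2 y"] \<delta> by (simp add: mult.commute)
  have "r \<cdot>\<^sub>v q = y + z"
  proof (cases "r = 0")
    case True
    with \<delta> d have y0: "norm2 y = 0"
      by auto
    with z_le have "norm2 z = 0"
      using norm2_nonneg[of z] by simp
    with y0 have "y = 0\<^sub>v m" "z = 0\<^sub>v m"
      using y z norm2_eq_0_iff by auto
    then show ?thesis
      using True D by (auto simp: Dy)
  next
    case False
    then show ?thesis
      by (simp add: D Dy smult_smult_assoc)
  qed
  moreover have "norm2 q = 0" if "r = 0"
    using that by (simp add: D norm2_smult)
  ultimately show ?thesis
    using that z z_le lower upper by blast
qed

text \<open>Both \<open>r * norm2 q\<close> and \<open>r\<close> are close to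
  \<open>norm2 y\<close>, so their quotient is close to 1. The lower bound assumes
  \<open>r \<noteq> 0\<close> because a breakdown returns \<open>q = 0\<close>.\<close>

lemma normalized_norm:
  assumes normalized: "normalized \<epsilon> \<omega> y r q" and y: "y \<in> carrier_vec m"
    and q: "q \<in> carrier_vec m"
    and d: "(real m / 2 + 1) * \<epsilon> + \<omega> \<le> d" "d < 1" "0 \<le> d" and \<epsilon>: "0 \<le> \<epsilon>" "\<epsilon> \<le> 1"
  shows "(1 - d) * norm2 q \<le> 1 + \<epsilon>" and "r \<noteq> 0 \<Longrightarrow> 1 - \<epsilon> \<le> (1 + d) * norm2 q"
proof -
  obtain z where z: "z \<in> carrier_vec m" "norm2 z \<le> \<epsilon> * norm2 y" "r \<cdot>\<^sub>v q = y + z"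
      and r: "(1 - d) * norm2 y \<le> r" "r \<le> (1 + d) * norm2 y" "r = 0 \<Longrightarrow> norm2 q = 0"
    using normalizedE[OF normalized y d(1,2)] by blast
  have r0: "0 \<le> r"
    using r(1) d by (meson diff_ge_0_iff_ge less_imp_le mult_nonneg_nonneg norm2_nonneg order_trans)
  have rq: "r * norm2 q = norm2 (y + z)"
    using r0 norm2_smult[of r q] by (simp add: z)
  have rq_bounds: "(1 - \<epsilon>) * norm2 y \<le> r * norm2 q" "r * norm2 q \<le> (1 + \<epsilon>) * norm2 y"
    using abs_norm2_diff_le[OF y z(1)] z(2) by (auto simp: rq algebra_simps)
  show "(1 - d) * norm2 q \<le> 1 + \<epsilon>"
  proof (cases "r = 0")
    case True
    then show ?thesis
      using r(3) \<epsilon> by simp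
  next
    case False
    with r0 have "0 < r"
      by simp
    have "((1 - d) * norm2 q) * r \<le> (1 - d) * ((1 + \<epsilon>) * norm2 y)"
      using rq_bounds(2) d by (simp add: mult.commute mult.left_commute mult_left_mono)
    also have "\<dots> \<le> (1 + \<epsilon>) * r"
      using mult_left_mono[OF r(1), of "1 + \<epsilon>"] \<epsilon> by (simp add: mult.left_commute)
    finally show ?thesis
      using \<open>0 < r\<close> by simp
  qed
  assume "r \<noteq> 0"
  with r0 have pos: "0 < r"
    by simp
  have "(1 - \<epsilon>) * r \<le> (1 - \<epsilon>) * ((1 + d) * norm2 y)"
    using \<epsilon> r(2) by (intro mult_left_mono) auto
  also have "\<dots> \<le> (1 + d) * (r * norm2 q)"
    using mult_left_mono[OF rq_bounds(1), of "1 + d"] d(3) by (simp add: mult.left_commute)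
  finally have "(1 - \<epsilon>) * r \<le> ((1 + d) * norm2 q) * r"
    by (simp add: mult_ac)
  then show "1 - \<epsilon> \<le> (1 + d) * norm2 q"
    using pos by simp
qed

lemma norm2_normalized_close:
  assumes normalized: "normalized \<epsilon> \<omega> y r q" and y: "y \<in> carrier_vec m"
    and q: "q \<in> carrier_vec m"
    and \<epsilon>: "0 < \<epsilon>" "(real m + 5)\<^sup>2 * \<epsilon> \<le> 1 / 8" and \<omega>: "\<omega> \<le> \<epsilon> / 4" and r: "r \<noteq> 0"
  shows "\<bar>1 - (norm2 q)\<^sup>2\<bar> \<le> (real m + 5) * \<epsilon>"
proof -
  \<comment> \<open>With \<omega> at most \<epsilon> / 4, \<open>c * \<epsilon>\<close> bounds the
    relative error of r. The constant a is c + 1 + 1/8: the 1 comes from the matrix D, and the 1/8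
    absorbs the second-order terms. Then 2 a + 1/8 is still below m + 5.\<close>
  define c where "c = real m / 2 + 5 / 4"
  define a where "a = real m / 2 + 19 / 8"
  have ac: "a * c * \<epsilon> \<le> 1 / 8" "a * a * \<epsilon> \<le> 1 / 8" "a * \<epsilon> \<le> 1 / 8" "c * \<epsilon> \<le> 1 / 8" "\<epsilon> \<le> 1 / 8"
  proof -
    have "x * \<epsilon> \<le> 1 / 8" if "x \<le> (real m + 5) * (real m + 5)" for x
    proof -
      have "x * \<epsilon> \<le> (real m + 5) * (real m + 5) * \<epsilon>"
        using that \<epsilon>(1) by (intro mult_right_mono) auto
      with \<epsilon>(2) show ?thesis
        unfolding power2_eq_square by linarith
    qed
    moreover have "a * c \<le> (real m + 5) * (real m + 5)" "a * a \<le> (real m + 5) * (real m + 5)"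
      "a * 1 \<le> (real m + 5) * (real m + 5)" "c * 1 \<le> (real m + 5) * (real m + 5)"
      "1 * 1 \<le> (real m + 5) * (real m + 5)"
      by (rule mult_mono; simp add: a_def c_def)+
    ultimately show "a * c * \<epsilon> \<le> 1 / 8" "a * a * \<epsilon> \<le> 1 / 8" "a * \<epsilon> \<le> 1 / 8" "c * \<epsilon> \<le> 1 / 8"
      "\<epsilon> \<le> 1 / 8"
      by (metis mult_1_right mult_1)+
  qed
  have acc: "a * c * \<epsilon> * \<epsilon> \<le> 1 / 8 * \<epsilon>" "a * a * \<epsilon> * \<epsilon> \<le> 1 / 8 * \<epsilon>"
    using ac \<epsilon> by (auto intro!: mult_right_mono simp del: mult_le_cancel_right_pos)
  have d: "(real m / 2 + 1) * \<epsilon> + \<omega> \<le> c * \<epsilon>" "c * \<epsilon> < 1" "0 \<le> c * \<epsilon>"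
    using \<omega> ac(4) \<epsilon> by (auto simp: c_def algebra_simps)
  have upper: "(1 - c * \<epsilon>) * norm2 q \<le> 1 + \<epsilon>" and lower: "1 - \<epsilon> \<le> (1 + c * \<epsilon>) * norm2 q"
    using normalized_norm[OF normalized y q d] \<epsilon> ac(5) r by auto
  have "(1 - c * \<epsilon>) * (1 + a * \<epsilon>) = 1 + (a - c) * \<epsilon> - a * c * \<epsilon> * \<epsilon>"
    by (simp add: algebra_simps)
  also have "(a - c) * \<epsilon> = \<epsilon> + 1 / 8 * \<epsilon>"
    by (simp add: a_def c_def algebra_simps)
  finally have "(1 - c * \<epsilon>) * norm2 q \<le> (1 - c * \<epsilon>) * (1 + a * \<epsilon>)"
    using upper acc by linarith
  then have q_le: "norm2 q \<le> 1 + a * \<epsilon>"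
    using d by simp
  have "(1 + c * \<epsilon>) * (1 - a * \<epsilon>) = 1 - (a - c) * \<epsilon> - a * c * \<epsilon> * \<epsilon>"
    by (simp add: algebra_simps)
  also have "(a - c) * \<epsilon> = \<epsilon> + 1 / 8 * \<epsilon>"
    by (simp add: a_def c_def algebra_simps)
  also have "1 - (\<epsilon> + 1 / 8 * \<epsilon>) - a * c * \<epsilon> * \<epsilon> \<le> 1 - \<epsilon>"
  proof -
    have "0 \<le> a * c * \<epsilon> * \<epsilon>"
      using \<epsilon> by (simp add: a_def c_def)
    with \<epsilon> show ?thesis
      by linarith
  qed
  finally have "(1 + c * \<epsilon>) * (1 - a * \<epsilon>) \<le> (1 + c * \<epsilon>) * norm2 q"
    using lower by linarith
  then have q_ge: "1 - a * \<epsilon> \<le> norm2 q"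
    using d by simp
  have "(norm2 q)\<^sup>2 \<le> (1 + a * \<epsilon>)\<^sup>2"
    using q_le by (intro power_mono) auto
  also have "\<dots> = 1 + 2 * (a * \<epsilon>) + a * a * \<epsilon> * \<epsilon>"
    by (simp add: power2_eq_square algebra_simps)
  finally have 1: "(norm2 q)\<^sup>2 \<le> 1 + 2 * (a * \<epsilon>) + 1 / 8 * \<epsilon>"
    using acc(2) by linarith
  have "(1 - a * \<epsilon>)\<^sup>2 \<le> (norm2 q)\<^sup>2"
    using q_ge ac(3) by (intro power_mono) auto
  moreover have "(1 - a * \<epsilon>)\<^sup>2 = 1 - 2 * (a * \<epsilon>) + (a * \<epsilon>) * (a * \<epsilon>)"
    by (simp add: power2_eq_square algebra_simps)
  ultimately have 2: "1 - 2 * (a * \<epsilon>) \<le> (norm2 q)\<^sup>2"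
    using zero_le_square[of "a * \<epsilon>"] by linarith
  have "2 * (a * \<epsilon>) + 1 / 8 * \<epsilon> \<le> (real m + 5) * \<epsilon>"
    using \<epsilon> by (simp add: a_def algebra_simps)
  with 1 2 \<epsilon> show ?thesis
    by linarith
qed

section \<open>One step with small errors\<close>

text \<open>One call of \<open>cgs2_step\<close> with a numerical tolerance \<tau> in place of
  asymptotic remainders. The remainder \<omega> is bounded in two ways because the first half-step
  acts on \<open>b\<close> and the second on a vector of norm about 1. The conditions on products
  with k^(1/2) (m + k) + 1 let constants absorb all second-order terms.\<close>

locale small_step =
  fixes m k :: nat and \<epsilon> \<omega> \<tau> e :: real and U :: "real mat" and b :: "real vec" and v :: cgs2_vals
  assumes U: "U \<in> carrier_mat m k" and b: "b \<in> carrier_vec m" and shape: "vals_shape m k v"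
    and defect: "spec_norm (1\<^sub>m k - transpose_mat U * U) \<le> e"
    and normalized: "step_normalized \<epsilon> \<omega> v"
    and bounds: "step_bounds \<epsilon> \<omega> U b v"
    and \<epsilon>: "0 < \<epsilon>" and \<beta>: "0 < norm2 b" and \<tau>: "0 < \<tau>" "\<tau> \<le> 1 / 100"
    and small_e: "e \<le> \<tau>" and small_\<epsilon>: "(real m / 2 + 2) * \<epsilon> \<le> \<tau>"
    and small_\<omega>: "\<omega> \<le> \<tau> * \<epsilon>" "\<omega> \<le> \<tau> * \<epsilon> * norm2 b"
    and small_\<epsilon>N: "\<epsilon> * (sqrt k * (real m + real k) + 1) \<le> \<tau>"
    and small_\<tau>N: "\<tau> * (sqrt k * (real m + real k) + 1) \<le> 1 / 20"
begin

text \<open>The combined rounding factor of the vectors \<open>s\<close> and \<open>y\<close> in one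
  half-step.\<close>

definition N :: real where
  "N = sqrt k * (real m + real k) + 1"

abbreviation "\<beta> \<equiv> norm2 b"
abbreviation "r\<^sub>1 \<equiv> val_r1 v"
abbreviation "r\<^sub>2 \<equiv> val_r2 v"
abbreviation "s\<^sub>1 \<equiv> val_s1 v"
abbreviation "s\<^sub>2 \<equiv> val_s2 v"
abbreviation "y\<^sub>1 \<equiv> val_y1 v"
abbreviation "y\<^sub>2 \<equiv> val_y2 v"
abbreviation "q\<^sub>1 \<equiv> val_q1 v"
abbreviation "q\<^sub>b \<equiv> val_qb v"
abbreviation "t \<equiv> norm2 (transpose_mat U *\<^sub>v q\<^sub>1)"

section \<open>Sizes of the quantities within a step\<close>

lemma carriers: "s\<^sub>1 \<in> carrier_vec k" "s\<^sub>2 \<in> carrier_vec k" "val_sb v \<in> carrier_vec k"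
  "y\<^sub>1 \<in> carrier_vec m" "q\<^sub>1 \<in> carrier_vec m" "y\<^sub>2 \<in> carrier_vec m" "q\<^sub>b \<in> carrier_vec m"
  using shape by (auto simp: vals_shape_def)

lemma e_nonneg: "0 \<le> e"
  using defect spec_norm_nonneg order_trans by blast

lemma N_ge_1: "1 \<le> N"
  by (simp add: N_def)

lemma small_N: "\<epsilon> * N \<le> \<tau>" "\<tau> * N \<le> 1 / 20"
  using small_\<epsilon>N small_\<tau>N by (auto simp: N_def)

lemma \<epsilon>_le: "\<epsilon> \<le> \<tau>"
proof -
  have "1 * \<epsilon> \<le> (real m / 2 + 2) * \<epsilon>"
    using \<epsilon> by (intro mult_right_mono) auto
  with small_\<epsilon> show ?thesis
    by simp
qed

lemma \<delta>_le: "(real m / 2 + 1) * \<epsilon> + \<omega> \<le> \<tau>" "\<tau> < 1" "0 \<le> \<tau>"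
proof -
  have "\<tau> * \<epsilon> \<le> 1 * \<epsilon>"
    using \<tau> \<epsilon> by (intro mult_right_mono) auto
  then show "(real m / 2 + 1) * \<epsilon> + \<omega> \<le> \<tau>"
    using small_\<epsilon> small_\<omega>(1) by (simp add: algebra_simps)
qed (use \<tau> in auto)

text \<open>The number \<open>g\<close> sets the scale on which \<omega> is small: it is
  \<open>norm2 b\<close> for the first half-step and 1 + 3 \<tau> for the second.\<close>

lemma half_step:
  assumes half: "half_step_bounds \<epsilon> \<omega> U c s y"
    and c: "c \<in> carrier_vec m" and s: "s \<in> carrier_vec k" and y: "y \<in> carrier_vec m"
    and g: "norm2 c \<le> g" "\<omega> \<le> \<tau> * \<epsilon> * g"
  defines "w \<equiv> transpose_mat U *\<^sub>v c"
  shows "norm2 y \<le> norm2 c + 2 * \<tau> * g"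
    and "\<bar>norm2 y - norm2 (c - U *\<^sub>v w)\<bar> \<le> 2 * \<tau> * g"
    and "norm2 (c - U *\<^sub>v w) \<le> norm2 c"
    and "norm2 (transpose_mat U *\<^sub>v y) \<le> e * norm2 w + \<epsilon> * (N + 1 / 5) * g"
proof -
  define h where "h = (1 + e) * (\<epsilon> * N * norm2 c + 2 * \<omega>)"
  have est: "\<bar>norm2 y - norm2 (c - U *\<^sub>v w)\<bar> \<le> h"
    "norm2 (transpose_mat U *\<^sub>v y) \<le> e * norm2 w + (1 + e) * h"
    using half_step_estimates[OF U defect c s y half] by (simp_all add: h_def w_def N_def)
  have g0: "0 \<le> g"
    using g(1) norm2_nonneg order_trans by blast
  have "\<epsilon> * N * norm2 c \<le> \<epsilon> * N * g"
    using \<epsilon> N_ge_1 g(1) by (intro mult_left_mono) auto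
  moreover have "\<epsilon> * (N + 2 * \<tau>) * g = \<epsilon> * N * g + 2 * (\<tau> * \<epsilon> * g)"
    by (simp add: algebra_simps)
  ultimately have inner: "\<epsilon> * N * norm2 c + 2 * \<omega> \<le> \<epsilon> * (N + 2 * \<tau>) * g"
    using g(2) by linarith
  have inner0: "0 \<le> \<epsilon> * (N + 2 * \<tau>) * g"
    using \<epsilon> N_ge_1 \<tau> g0 by simp
  have h: "h \<le> (1 + \<tau>) * (\<epsilon> * (N + 2 * \<tau>) * g)"
    unfolding h_def using inner inner0 small_e e_nonneg \<tau>
    by (meson add_left_mono add_nonneg_nonneg less_imp_le mult_left_mono mult_right_mono order_trans
        zero_le_one)
  have "\<epsilon> * (2 * \<tau>) \<le> \<tau> * (2 * \<tau>)"
    using \<epsilon>_le \<tau> by (intro mult_right_mono) auto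
  with small_N(1) have "\<epsilon> * (N + 2 * \<tau>) \<le> \<tau> * (1 + 2 * \<tau>)"
    unfolding distrib_left by linarith
  also have "\<dots> \<le> \<tau> * (3 / 2)"
    using \<tau> by (intro mult_left_mono) auto
  finally have product: "\<epsilon> * (N + 2 * \<tau>) \<le> \<tau> * (3 / 2)" .
  have "(1 + \<tau>) * (\<epsilon> * (N + 2 * \<tau>)) \<le> (4 / 3) * (\<tau> * (3 / 2))"
    by (rule mult_mono[OF _ product]) (use \<tau> \<epsilon> N_ge_1 in auto)
  then have "(1 + \<tau>) * (\<epsilon> * (N + 2 * \<tau>)) * g \<le> 2 * \<tau> * g"
    using g0 by (intro mult_right_mono) auto
  with h have h2: "h \<le> 2 * \<tau> * g"
    by (simp add: mult.assoc)
  with est(1) show "\<bar>norm2 y - norm2 (c - U *\<^sub>v w)\<bar> \<le> 2 * \<tau> * g"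
    by simp
  \<comment> \<open>As e is at most 1, the error in near-Pythagoras cannot outweigh the squared norm
    of \<open>w\<close> that is subtracted, so the projection does not lengthen
    \<open>c\<close>.\<close>
  have "e * (norm2 w)\<^sup>2 \<le> 1 * (norm2 w)\<^sup>2"
    using small_e \<tau> by (intro mult_right_mono) auto
  then have "(norm2 (c - U *\<^sub>v w))\<^sup>2 \<le> (norm2 c)\<^sup>2"
    using projection_norm[OF U defect c, folded w_def] by linarith
  then show p: "norm2 (c - U *\<^sub>v w) \<le> norm2 c"
    by (rule power2_le_imp_le) simp
  show "norm2 y \<le> norm2 c + 2 * \<tau> * g"
    using est(1) h2 p by linarith
  \<comment> \<open>The summand 1/5 pays for the two factors 1 + e and for the two remainders
    \<omega>.\<close>
  have "(1 + \<tau>) * ((1 + \<tau>) * (N + 2 * \<tau>)) = N + 2 * (\<tau> * N) + 2 * \<tau> + \<tau> * (\<tau> * N) + 4 * \<tau>\<^sup>2 + 2 * \<tau>^3"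
    by (simp add: algebra_simps power2_eq_square power3_eq_cube)
  also have "\<dots> \<le> N + 2 * (1 / 20) + 2 * (1 / 100) + 1 / 100 * (1 / 20) + 4 * (1 / 100)\<^sup>2 + 2 * (1 / 100) ^ 3"
    using \<tau> small_N(2) N_ge_1 by (intro add_mono mult_mono power_mono) auto
  also have "\<dots> \<le> N + 1 / 5"
    by (simp add: field_simps)
  finally have "(1 + \<tau>) * ((1 + \<tau>) * (N + 2 * \<tau>)) * (\<epsilon> * g) \<le> (N + 1 / 5) * (\<epsilon> * g)"
    using \<epsilon> g0 by (intro mult_right_mono) auto
  moreover have "(1 + e) * h \<le> (1 + \<tau>) * ((1 + \<tau>) * (\<epsilon> * (N + 2 * \<tau>) * g))"
    using h inner0 small_e e_nonneg \<tau>
    by (meson add_left_mono add_nonneg_nonneg less_imp_le mult_left_mono mult_right_mono order_trans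
        zero_le_one mult_nonneg_nonneg)
  ultimately have "(1 + e) * h \<le> \<epsilon> * (N + 1 / 5) * g"
    by (simp add: mult_ac)
  with est(2) show "norm2 (transpose_mat U *\<^sub>v y) \<le> e * norm2 w + \<epsilon> * (N + 1 / 5) * g"
    by linarith
qed

lemma norm_y1: "norm2 y\<^sub>1 \<le> (1 + 2 * \<tau>) * \<beta>"
proof -
  have "half_step_bounds \<epsilon> \<omega> U b s\<^sub>1 y\<^sub>1"
    using bounds by (simp add: step_bounds_def)
  from half_step(1)[OF this b carriers(1,4) order_refl small_\<omega>(2)]
  show ?thesis
    by (simp add: algebra_simps)
qed

lemma normalized_y: "normalized \<epsilon> \<omega> y\<^sub>1 r\<^sub>1 q\<^sub>1" "normalized \<epsilon> \<omega> y\<^sub>2 r\<^sub>2 q\<^sub>b"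
  using normalized by (auto simp: step_normalized_def)

lemma norm_q_le:
  assumes "(1 - \<tau>) * x \<le> 1 + \<epsilon>"
  shows "x \<le> 1 + 3 * \<tau>"
proof -
  have "\<tau> * \<tau> \<le> \<tau> * (1 / 100)"
    using \<tau> by (intro mult_left_mono) auto
  moreover have "(1 - \<tau>) * (1 + 3 * \<tau>) = 1 + 2 * \<tau> - 3 * (\<tau> * \<tau>)"
    by (simp add: algebra_simps)
  ultimately have "1 + \<epsilon> \<le> (1 - \<tau>) * (1 + 3 * \<tau>)"
    using \<epsilon>_le \<tau> by linarith
  with assms have "(1 - \<tau>) * x \<le> (1 - \<tau>) * (1 + 3 * \<tau>)"
    by linarith
  then show ?thesis
    using \<tau> by simp
qed

lemma norm_q1: "norm2 q\<^sub>1 \<le> 1 + 3 * \<tau>"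
  using norm_q_le[OF normalized_norm(1)[OF normalized_y(1) carriers(4,5) \<delta>_le]] \<epsilon> \<epsilon>_le \<tau> by simp

lemma norm_qb: "norm2 q\<^sub>b \<le> 1 + 3 * \<tau>"
  using norm_q_le[OF normalized_norm(1)[OF normalized_y(2) carriers(6,7) \<delta>_le]] \<epsilon> \<epsilon>_le \<tau> by simp

lemma norm_q1_ge:
  assumes "r\<^sub>1 \<noteq> 0"
  shows "1 - 2 * \<tau> \<le> norm2 q\<^sub>1"
proof -
  have "(1 - 2 * \<tau>) * (1 + \<tau>) = 1 - \<tau> - 2 * (\<tau> * \<tau>)"
    by (simp add: algebra_simps)
  also have "\<dots> \<le> 1 - \<epsilon>"
    using \<epsilon>_le zero_le_square[of \<tau>] by linarith
  also have "1 - \<epsilon> \<le> norm2 q\<^sub>1 * (1 + \<tau>)"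
    using normalized_norm(2)[OF normalized_y(1) carriers(4,5) \<delta>_le _ _ assms] \<epsilon> \<epsilon>_le \<tau>
    by (simp add: mult.commute)
  finally show ?thesis
    using \<tau> by simp
qed

lemma half_step_q1:
  shows "norm2 y\<^sub>2 \<le> 1 + 6 * \<tau>"
    and "\<bar>norm2 y\<^sub>2 - norm2 (q\<^sub>1 - U *\<^sub>v (transpose_mat U *\<^sub>v q\<^sub>1))\<bar> \<le> 3 * \<tau>"
    and "norm2 (transpose_mat U *\<^sub>v y\<^sub>2) \<le> e * t + \<epsilon> * (N + 1 / 2)"
proof -
  have "half_step_bounds \<epsilon> \<omega> U q\<^sub>1 s\<^sub>2 y\<^sub>2"
    using bounds by (simp add: step_bounds_def)
  moreover have "\<tau> * \<epsilon> * 1 \<le> \<tau> * \<epsilon> * (1 + 3 * \<tau>)"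
    using \<tau> \<epsilon> by (intro mult_left_mono) auto
  ultimately have half: "norm2 y\<^sub>2 \<le> norm2 q\<^sub>1 + 2 * \<tau> * (1 + 3 * \<tau>)"
    "\<bar>norm2 y\<^sub>2 - norm2 (q\<^sub>1 - U *\<^sub>v (transpose_mat U *\<^sub>v q\<^sub>1))\<bar> \<le> 2 * \<tau> * (1 + 3 * \<tau>)"
    "norm2 (transpose_mat U *\<^sub>v y\<^sub>2) \<le> e * t + \<epsilon> * (N + 1 / 5) * (1 + 3 * \<tau>)"
    using half_step[OF _ carriers(5,2,6) norm_q1] small_\<omega>(1) by simp_all
  have "2 * (1 + 3 * \<tau>) * \<tau> \<le> 3 * \<tau>"
    using \<tau> by (intro mult_right_mono) auto
  then have eq: "2 * \<tau> * (1 + 3 * \<tau>) \<le> 3 * \<tau>"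
    by (simp only: mult_ac)
  show "norm2 y\<^sub>2 \<le> 1 + 6 * \<tau>"
    using half(1) eq norm_q1 by linarith
  show "\<bar>norm2 y\<^sub>2 - norm2 (q\<^sub>1 - U *\<^sub>v (transpose_mat U *\<^sub>v q\<^sub>1))\<bar> \<le> 3 * \<tau>"
    using half(2) eq by linarith
  have "(N + 1 / 5) * (1 + 3 * \<tau>) \<le> N + 1 / 2"
    using small_N(2) \<tau> by (simp add: algebra_simps)
  then have "\<epsilon> * ((N + 1 / 5) * (1 + 3 * \<tau>)) \<le> \<epsilon> * (N + 1 / 2)"
    using \<epsilon> by (intro mult_left_mono) auto
  with half(3) show "norm2 (transpose_mat U *\<^sub>v y\<^sub>2) \<le> e * t + \<epsilon> * (N + 1 / 2)"
    by (simp only: mult.assoc)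
qed

text \<open>The product \<open>r\<^sub>1 * norm2 q\<^sub>1\<close> is read off from
  \<open>r\<^sub>1 \<cdot>\<^sub>v q\<^sub>1 = y\<^sub>1 + z\<close> instead of multiplying separate
  bounds for its factors.\<close>

lemma r1_bounds: "0 \<le> r\<^sub>1" "r\<^sub>1 \<le> (1 + 4 * \<tau>) * \<beta>" "r\<^sub>1 * norm2 q\<^sub>1 \<le> (1 + 4 * \<tau>) * \<beta>"
proof -
  obtain z where z: "z \<in> carrier_vec m" "norm2 z \<le> \<epsilon> * norm2 y\<^sub>1" "r\<^sub>1 \<cdot>\<^sub>v q\<^sub>1 = y\<^sub>1 + z"
      and r: "(1 - \<tau>) * norm2 y\<^sub>1 \<le> r\<^sub>1" "r\<^sub>1 \<le> (1 + \<tau>) * norm2 y\<^sub>1"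
    using normalizedE[OF normalized_y(1) carriers(4) \<delta>_le(1,2)] by blast
  have "0 \<le> (1 - \<tau>) * norm2 y\<^sub>1"
    using \<tau> by simp
  with r show r0: "0 \<le> r\<^sub>1"
    by linarith
  have "\<tau> * \<tau> \<le> \<tau> * (1 / 100)"
    using \<tau> by (intro mult_left_mono) auto
  moreover have "(1 + \<tau>) * (1 + 2 * \<tau>) = 1 + 3 * \<tau> + 2 * (\<tau> * \<tau>)"
    by (simp add: algebra_simps)
  ultimately have "(1 + \<tau>) * (1 + 2 * \<tau>) \<le> 1 + 4 * \<tau>"
    using \<tau> by linarith
  then have "(1 + \<tau>) * (1 + 2 * \<tau>) * \<beta> \<le> (1 + 4 * \<tau>) * \<beta>"
    using \<beta> by (intro mult_right_mono) auto
  moreover have "(1 + \<tau>) * norm2 y\<^sub>1 \<le> (1 + \<tau>) * ((1 + 2 * \<tau>) * \<beta>)"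
    using norm_y1 \<tau> by (intro mult_left_mono) auto
  ultimately have y1: "(1 + \<tau>) * norm2 y\<^sub>1 \<le> (1 + 4 * \<tau>) * \<beta>"
    by (simp add: mult.assoc)
  with r show "r\<^sub>1 \<le> (1 + 4 * \<tau>) * \<beta>"
    by linarith
  have "r\<^sub>1 * norm2 q\<^sub>1 = norm2 (y\<^sub>1 + z)"
    using r0 norm2_smult[of r\<^sub>1 q\<^sub>1] by (simp add: z)
  also have "\<dots> \<le> norm2 y\<^sub>1 + \<tau> * norm2 y\<^sub>1"
    using norm2_add_le[OF carriers(4) z(1)] z(2) mult_right_mono[OF \<epsilon>_le, of "norm2 y\<^sub>1"] by simp
  finally show "r\<^sub>1 * norm2 q\<^sub>1 \<le> (1 + 4 * \<tau>) * \<beta>"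
    using y1 by (simp add: algebra_simps)
qed

section \<open>The residual of one step\<close>

text \<open>Substituting the relations of the step into each other leaves only the errors of
  \<open>y\<^sub>1\<close>, \<open>y\<^sub>2\<close>, the two normalizations and the final updates.
  The errors of \<open>s\<^sub>1\<close> and \<open>s\<^sub>2\<close> drop out since
  \<open>y\<^sub>1\<close> and \<open>y\<^sub>2\<close> are compared with the computed coefficients;
  hence the bound does not involve m.\<close>

lemma residual:
  "norm2 (b - (U *\<^sub>v val_sb v + val_rb v \<cdot>\<^sub>v q\<^sub>b)) \<le> \<epsilon> * \<beta> * (15 + 2 * real k * sqrt k)"
proof -
  \<comment> \<open>The rounding factor of \<open>y\<close> alone, that is 1 + k^(3/2).\<close>
  define K where "K = 1 + real k * sqrt k"
  have K: "0 \<le> K" "\<tau> * K \<le> 1 / 20"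
  proof -
    have "K \<le> N"
      by (simp add: K_def N_def algebra_simps)
    then have "\<tau> * K \<le> \<tau> * N"
      using \<tau> by (intro mult_left_mono) auto
    then show "\<tau> * K \<le> 1 / 20"
      using small_N(2) by linarith
  qed (simp add: K_def)
  obtain z1 where z1: "z1 \<in> carrier_vec m" "norm2 z1 \<le> \<epsilon> * norm2 y\<^sub>1" "r\<^sub>1 \<cdot>\<^sub>v q\<^sub>1 = y\<^sub>1 + z1"
    using normalizedE[OF normalized_y(1) carriers(4) \<delta>_le(1,2)] by blast
  obtain z2 where z2: "z2 \<in> carrier_vec m" "norm2 z2 \<le> \<epsilon> * norm2 y\<^sub>2" "r\<^sub>2 \<cdot>\<^sub>v q\<^sub>b = y\<^sub>2 + z2"
    using normalizedE[OF normalized_y(2) carriers(6) \<delta>_le(1,2)] by blast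
  obtain \<delta>y1 where \<delta>y1: "\<delta>y1 \<in> carrier_vec m" "y\<^sub>1 + \<delta>y1 = b - U *\<^sub>v s\<^sub>1"
      "norm2 \<delta>y1 \<le> \<epsilon> * K * \<beta> + \<omega>"
    using bounds U unfolding step_bounds_def half_step_bounds_def Let_def K_def by (auto simp: nat_powr_three_halves)
  obtain \<delta>y2 where \<delta>y2: "\<delta>y2 \<in> carrier_vec m" "y\<^sub>2 + \<delta>y2 = q\<^sub>1 - U *\<^sub>v s\<^sub>2"
      "norm2 \<delta>y2 \<le> \<epsilon> * K * norm2 q\<^sub>1 + \<omega>"
    using bounds U unfolding step_bounds_def half_step_bounds_def Let_def K_def by (auto simp: nat_powr_three_halves)
  obtain \<delta>s where \<delta>s: "\<delta>s \<in> carrier_vec k" "val_sb v + \<delta>s = s\<^sub>1 + r\<^sub>1 \<cdot>\<^sub>v s\<^sub>2"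
      "norm2 \<delta>s \<le> 2 * \<epsilon> * \<beta> + \<omega>"
    using bounds U unfolding step_bounds_def by auto
  obtain \<delta>r where \<delta>r: "val_rb v + \<delta>r = r\<^sub>2 * r\<^sub>1" "\<bar>\<delta>r\<bar> \<le> \<epsilon> * \<beta> + \<omega>"
    using bounds unfolding step_bounds_def by auto
  have Us: "U *\<^sub>v val_sb v + U *\<^sub>v \<delta>s = U *\<^sub>v s\<^sub>1 + r\<^sub>1 \<cdot>\<^sub>v (U *\<^sub>v s\<^sub>2)"
  proof -
    have "U *\<^sub>v val_sb v + U *\<^sub>v \<delta>s = U *\<^sub>v (s\<^sub>1 + r\<^sub>1 \<cdot>\<^sub>v s\<^sub>2)"
      using U carriers \<delta>s(1) by (simp flip: \<delta>s(2) add: mult_add_distrib_mat_vec)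
    also have "\<dots> = U *\<^sub>v s\<^sub>1 + U *\<^sub>v (r\<^sub>1 \<cdot>\<^sub>v s\<^sub>2)"
      using U carriers by (intro mult_add_distrib_mat_vec) auto
    also have "U *\<^sub>v (r\<^sub>1 \<cdot>\<^sub>v s\<^sub>2) = r\<^sub>1 \<cdot>\<^sub>v (U *\<^sub>v s\<^sub>2)"
      using U carriers by (intro mult_mat_vec) auto
    finally show ?thesis .
  qed
  have U\<delta>s: "U *\<^sub>v \<delta>s \<in> carrier_vec m"
    using U \<delta>s(1) by auto
  have eq: "b - (U *\<^sub>v val_sb v + val_rb v \<cdot>\<^sub>v q\<^sub>b) =
      U *\<^sub>v \<delta>s + \<delta>r \<cdot>\<^sub>v q\<^sub>b + r\<^sub>1 \<cdot>\<^sub>v (\<delta>y2 - z2) + (\<delta>y1 - z1)" (is "?lhs = ?rhs")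
  proof (rule eq_vecI)
    fix i assume "i < dim_vec ?rhs"
    then have i: "i < m"
      using z1 by simp
    note [simp] = i carrier_vecD[OF U\<delta>s] carrier_vecD[OF z1(1)] carrier_vecD[OF z2(1)]
      carrier_vecD[OF \<delta>y1(1)] carrier_vecD[OF \<delta>y2(1)] carrier_vecD[OF b]
      carrier_matD[OF U] carriers(4-7)[THEN carrier_vecD]
    define u1 u2 ub ud where "u1 = (U *\<^sub>v s\<^sub>1) $ i" and "u2 = (U *\<^sub>v s\<^sub>2) $ i"
      and "ub = (U *\<^sub>v val_sb v) $ i" and "ud = (U *\<^sub>v \<delta>s) $ i"
    have 1: "y\<^sub>1 $ i + \<delta>y1 $ i = b $ i - u1"
      using arg_cong[OF \<delta>y1(2), of "\<lambda>x. x $ i"] by (simp add: u1_def)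
    have 2: "y\<^sub>2 $ i + \<delta>y2 $ i = q\<^sub>1 $ i - u2"
      using arg_cong[OF \<delta>y2(2), of "\<lambda>x. x $ i"] by (simp add: u2_def)
    have 3: "r\<^sub>1 * q\<^sub>1 $ i = y\<^sub>1 $ i + z1 $ i"
      using arg_cong[OF z1(3), of "\<lambda>x. x $ i"] by simp
    have 4: "r\<^sub>2 * q\<^sub>b $ i = y\<^sub>2 $ i + z2 $ i"
      using arg_cong[OF z2(3), of "\<lambda>x. x $ i"] by simp
    have 5: "ub + ud = u1 + r\<^sub>1 * u2"
      using arg_cong[OF Us, of "\<lambda>x. x $ i"] by (simp add: u1_def u2_def ub_def ud_def)
    have "b $ i - (ub + val_rb v * q\<^sub>b $ i) =
        ud + \<delta>r * q\<^sub>b $ i + r\<^sub>1 * (\<delta>y2 $ i - z2 $ i) + (\<delta>y1 $ i - z1 $ i)"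
    proof -
      have "r\<^sub>1 * q\<^sub>1 $ i = r\<^sub>1 * u2 + r\<^sub>1 * y\<^sub>2 $ i + r\<^sub>1 * \<delta>y2 $ i"
        using 2 by (simp flip: distrib_left)
      moreover have "r\<^sub>1 * (r\<^sub>2 * q\<^sub>b $ i) = r\<^sub>1 * y\<^sub>2 $ i + r\<^sub>1 * z2 $ i"
        using 4 by (simp flip: distrib_left)
      moreover have "val_rb v * q\<^sub>b $ i + \<delta>r * q\<^sub>b $ i = r\<^sub>1 * (r\<^sub>2 * q\<^sub>b $ i)"
        using \<delta>r(1) by (simp flip: distrib_right)
      ultimately show ?thesis
        using 1 3 5 unfolding right_diff_distrib by linarith
    qed
    then show "?lhs $ i = ?rhs $ i"
      by (simp add: ub_def ud_def)
  qed (use b z1 carriers(7) in auto)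
  define x where "x = \<epsilon> * \<beta>"
  have x: "0 < x"
    using \<epsilon> \<beta> by (simp add: x_def)
  have \<omega>x: "\<omega> \<le> x / 100"
  proof -
    have "\<tau> * x \<le> 1 / 100 * x"
      using \<tau> x by (intro mult_right_mono) auto
    with small_\<omega>(2) show ?thesis
      by (simp add: x_def mult.assoc)
  qed
  have 1: "norm2 (U *\<^sub>v \<delta>s) \<le> 21 / 10 * x"
  proof -
    have "norm2 (U *\<^sub>v \<delta>s) \<le> (1 + e) * norm2 \<delta>s"
      by (rule norm2_near_isometry_le[OF U defect \<delta>s(1)])
    also have "\<dots> \<le> (101 / 100) * (201 / 100 * x)"
      using small_e \<tau> e_nonneg \<delta>s(3) \<omega>x by (intro mult_mono) (auto simp: x_def)
    also have "\<dots> \<le> 21 / 10 * x"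
      using x by simp
    finally show ?thesis .
  qed
  have 2: "norm2 (\<delta>r \<cdot>\<^sub>v q\<^sub>b) \<le> 11 / 10 * x"
  proof -
    have "\<bar>\<delta>r\<bar> * norm2 q\<^sub>b \<le> (101 / 100 * x) * (103 / 100)"
      using \<delta>r(2) norm_qb \<omega>x \<tau> x by (intro mult_mono) (auto simp: x_def)
    also have "\<dots> \<le> 11 / 10 * x"
      using x by simp
    finally show ?thesis
      by (simp add: norm2_smult)
  qed
  have "(1 + 4 * \<tau>) * \<beta> \<le> 104 / 100 * \<beta>"
    using \<tau> \<beta> by (intro mult_right_mono) auto
  with r1_bounds(2) have r1: "r\<^sub>1 \<le> 104 / 100 * \<beta>"
    by linarith
  have 3: "norm2 (r\<^sub>1 \<cdot>\<^sub>v (\<delta>y2 - z2)) \<le> K * x + 3 / 2 * x"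
  proof -
    have "norm2 (r\<^sub>1 \<cdot>\<^sub>v (\<delta>y2 - z2)) \<le> r\<^sub>1 * (norm2 \<delta>y2 + norm2 z2)"
      using norm2_diff_le[OF \<delta>y2(1) z2(1)] r1_bounds(1) by (simp add: norm2_smult mult_left_mono)
    also have "\<dots> \<le> r\<^sub>1 * ((\<epsilon> * K * norm2 q\<^sub>1 + 1 / 100 * \<epsilon>) + 106 / 100 * \<epsilon>)"
    proof (intro mult_left_mono add_mono r1_bounds(1))
      have "\<tau> * \<epsilon> \<le> 1 / 100 * \<epsilon>"
        using \<tau> \<epsilon> by (intro mult_right_mono) auto
      then show "norm2 \<delta>y2 \<le> \<epsilon> * K * norm2 q\<^sub>1 + 1 / 100 * \<epsilon>"
        using \<delta>y2(3) small_\<omega>(1) by linarith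
      have "\<epsilon> * norm2 y\<^sub>2 \<le> \<epsilon> * (106 / 100)"
        using half_step_q1(1) \<tau> \<epsilon> by (intro mult_left_mono) auto
      then show "norm2 z2 \<le> 106 / 100 * \<epsilon>"
        using z2(2) by linarith
    qed
    also have "\<dots> = (\<epsilon> * K) * (r\<^sub>1 * norm2 q\<^sub>1) + r\<^sub>1 * (107 / 100 * \<epsilon>)"
      by (simp add: algebra_simps)
    also have "\<dots> \<le> (\<epsilon> * K) * ((1 + 4 * \<tau>) * \<beta>) + (104 / 100 * \<beta>) * (107 / 100 * \<epsilon>)"
      using \<epsilon> K r1_bounds r1 by (intro add_mono mult_left_mono mult_right_mono) auto
    also have "\<dots> = K * x + 4 * (\<tau> * K) * x + (104 / 100 * (107 / 100)) * x"
      by (simp add: x_def algebra_simps)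
    also have "4 * (\<tau> * K) * x \<le> 1 / 5 * x"
      using K x by (intro mult_right_mono) auto
    finally show ?thesis
      using x by (simp add: algebra_simps)
  qed
  have 4: "norm2 (\<delta>y1 - z1) \<le> K * x + 103 / 100 * x"
  proof -
    have "(1 + 2 * \<tau>) * \<beta> \<le> 102 / 100 * \<beta>"
      using \<tau> \<beta> by (intro mult_right_mono) auto
    then have "\<epsilon> * norm2 y\<^sub>1 \<le> \<epsilon> * (102 / 100 * \<beta>)"
      using norm_y1 \<epsilon> by (intro mult_left_mono) auto
    then have "norm2 z1 \<le> 102 / 100 * x"
      using z1(2) by (simp add: x_def)
    moreover have "norm2 \<delta>y1 \<le> K * x + x / 100"
      using \<delta>y1(3) \<omega>x by (simp add: x_def mult_ac)
    ultimately show ?thesis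
      using norm2_diff_le[OF \<delta>y1(1) z1(1)] by linarith
  qed
  have "norm2 ?lhs \<le> norm2 (U *\<^sub>v \<delta>s + \<delta>r \<cdot>\<^sub>v q\<^sub>b + r\<^sub>1 \<cdot>\<^sub>v (\<delta>y2 - z2)) + norm2 (\<delta>y1 - z1)"
    unfolding eq using U\<delta>s \<delta>y1 \<delta>y2 z1 z2 carriers by (intro norm2_add_le[of _ m]) auto
  also have "norm2 (U *\<^sub>v \<delta>s + \<delta>r \<cdot>\<^sub>v q\<^sub>b + r\<^sub>1 \<cdot>\<^sub>v (\<delta>y2 - z2)) \<le>
      norm2 (U *\<^sub>v \<delta>s + \<delta>r \<cdot>\<^sub>v q\<^sub>b) + norm2 (r\<^sub>1 \<cdot>\<^sub>v (\<delta>y2 - z2))"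
    using U\<delta>s \<delta>y2 z2 carriers by (intro norm2_add_le[of _ m]) auto
  also have "norm2 (U *\<^sub>v \<delta>s + \<delta>r \<cdot>\<^sub>v q\<^sub>b) \<le> norm2 (U *\<^sub>v \<delta>s) + norm2 (\<delta>r \<cdot>\<^sub>v q\<^sub>b)"
    using U\<delta>s carriers by (intro norm2_add_le[of _ m]) auto
  \<comment> \<open>Besides 2 K x the four parts contribute 2.1, 1.1, 1.5 and 1.03 times x, well
    below 13. With K = 1 + k^(3/2) this becomes the stated 15 + 2 k^(3/2).\<close>
  finally have "norm2 ?lhs \<le> 2 * (K * x) + 13 * x"
    using 1 2 3 4 x by linarith
  also have "\<dots> = x * (15 + 2 * real k * sqrt k)"
    by (simp add: K_def algebra_simps)
  finally show ?thesis
    by (simp add: x_def)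
qed

section \<open>Loss of orthogonality in one step\<close>

text \<open>Three approximations are chained: \<open>r\<^sub>2\<close> by
  \<open>norm2 y\<^sub>2\<close> (normalization), that by the exact projection norm \<open>p\<close>
  (half-step errors), and \<open>p\<^sup>2\<close> by near-Pythagoras.\<close>

lemma r2_near_projection:
  defines "p \<equiv> norm2 (q\<^sub>1 - U *\<^sub>v (transpose_mat U *\<^sub>v q\<^sub>1))"
  shows "0 \<le> r\<^sub>2" and "(1 - \<tau>) * norm2 y\<^sub>2 \<le> r\<^sub>2"
    and "\<bar>r\<^sub>2\<^sup>2 - p\<^sup>2\<bar> \<le> 10 * \<tau>" and "\<bar>p\<^sup>2 - ((norm2 q\<^sub>1)\<^sup>2 - t\<^sup>2)\<bar> \<le> 2 * \<tau>"
proof -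
  show lower: "(1 - \<tau>) * norm2 y\<^sub>2 \<le> r\<^sub>2"
    using normalizedE[OF normalized_y(2) carriers(6) \<delta>_le(1,2)] by blast
  have upper: "r\<^sub>2 \<le> (1 + \<tau>) * norm2 y\<^sub>2"
    using normalizedE[OF normalized_y(2) carriers(6) \<delta>_le(1,2)] by blast
  have "0 \<le> (1 - \<tau>) * norm2 y\<^sub>2"
    using \<tau> by simp
  with lower show r0: "0 \<le> r\<^sub>2"
    by linarith
  have t: "t \<le> 105 / 100"
  proof -
    have "t \<le> (1 + e) * norm2 q\<^sub>1"
      by (rule norm2_transpose_near_isometry_le[OF U defect carriers(5)])
    also have "\<dots> \<le> (101 / 100) * (103 / 100)"
      using small_e e_nonneg \<tau> norm_q1 by (intro mult_mono) auto
    finally show ?thesis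
      by simp
  qed
  have t2: "t\<^sup>2 \<le> 2"
    using power_mono[OF t, of 2] by (simp add: power2_eq_square)
  have "e * t\<^sup>2 \<le> \<tau> * 2"
    using small_e \<tau> t2 by (intro mult_mono) auto
  then show "\<bar>p\<^sup>2 - ((norm2 q\<^sub>1)\<^sup>2 - t\<^sup>2)\<bar> \<le> 2 * \<tau>"
    using projection_norm[OF U defect carriers(5)] unfolding p_def by linarith
  have y2: "norm2 y\<^sub>2 \<le> 106 / 100"
    using half_step_q1(1) \<tau> by simp
  then have y2': "\<tau> * norm2 y\<^sub>2 \<le> \<tau> * (106 / 100)"
    using \<tau> by (intro mult_left_mono) auto
  note y2_p = half_step_q1(2)[folded p_def]
  \<comment> \<open>The half-step contributes 3 \<tau> and the normalization 1.06 \<tau>.\<close>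
  have close: "\<bar>r\<^sub>2 - p\<bar> \<le> 41 / 10 * \<tau>"
    using lower upper y2_p \<tau> y2' unfolding left_diff_distrib distrib_right mult_1 by linarith
  have "r\<^sub>2 \<le> 108 / 100" "p \<le> 110 / 100"
    using upper y2 y2' y2_p \<tau> unfolding distrib_right mult_1 by linarith+
  then have sum: "\<bar>r\<^sub>2 + p\<bar> \<le> 218 / 100"
    using r0 by (simp add: p_def)
  have "r\<^sub>2\<^sup>2 - p\<^sup>2 = (r\<^sub>2 - p) * (r\<^sub>2 + p)"
    by (simp add: power2_eq_square algebra_simps)
  then have "\<bar>r\<^sub>2\<^sup>2 - p\<^sup>2\<bar> = \<bar>r\<^sub>2 - p\<bar> * \<bar>r\<^sub>2 + p\<bar>"
    by (simp add: abs_mult)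
  also have "\<dots> \<le> (41 / 10 * \<tau>) * (218 / 100)"
    using close sum \<tau> by (intro mult_mono) auto
  finally show "\<bar>r\<^sub>2\<^sup>2 - p\<^sup>2\<bar> \<le> 10 * \<tau>"
    using \<tau> by simp
qed

lemma energy_upper: "t\<^sup>2 + r\<^sub>2\<^sup>2 \<le> 1 + 20 * \<tau>"
proof -
  have "(norm2 q\<^sub>1)\<^sup>2 \<le> (1 + 3 * \<tau>)\<^sup>2"
    using norm_q1 by (intro power_mono) auto
  also have "\<dots> = 1 + 6 * \<tau> + 9 * (\<tau> * \<tau>)"
    by (simp add: power2_eq_square algebra_simps)
  also have "\<tau> * \<tau> \<le> \<tau> * (1 / 100)"
    using \<tau> by (intro mult_left_mono) auto
  finally show ?thesis
    using r2_near_projection(3,4) \<tau> by linarith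
qed

text \<open>In contrast to the upper bound this assumes \<open>r\<^sub>1 \<noteq> 0\<close>: after a
  breakdown \<open>q\<^sub>1\<close> is zero and the energy is not close to 1.\<close>

lemma energy_lower:
  assumes "r\<^sub>1 \<noteq> 0"
  shows "1 - 20 * \<tau> \<le> t\<^sup>2 + r\<^sub>2\<^sup>2"
proof -
  have "(1 - 2 * \<tau>)\<^sup>2 \<le> (norm2 q\<^sub>1)\<^sup>2"
    using norm_q1_ge[OF assms] \<tau> by (intro power_mono) auto
  moreover have "(1 - 2 * \<tau>)\<^sup>2 = 1 - 4 * \<tau> + 4 * (\<tau> * \<tau>)"
    by (simp add: power2_eq_square algebra_simps)
  ultimately show ?thesis
    using r2_near_projection(3,4) \<tau> zero_le_square[of \<tau>] by linarith
qed

text \<open>Apply U^T to \<open>r\<^sub>1 \<cdot>\<^sub>v q\<^sub>1 = y\<^sub>1 + z\<close>. The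
  defect acting on U^T b gives f, the half-step gives N, and the 2 covers the normalization error
  together with all second-order terms.\<close>

lemma first_coefficient:
  assumes e_f: "e = \<epsilon> * f" and f: "0 \<le> f" "\<tau> * f \<le> 1 / 20"
  shows "r\<^sub>1 * t \<le> \<epsilon> * \<beta> * (f + N + 2)"
proof -
  obtain z where z: "z \<in> carrier_vec m" "norm2 z \<le> \<epsilon> * norm2 y\<^sub>1" "r\<^sub>1 \<cdot>\<^sub>v q\<^sub>1 = y\<^sub>1 + z"
    using normalizedE[OF normalized_y(1) carriers(4) \<delta>_le(1,2)] by blast
  have "half_step_bounds \<epsilon> \<omega> U b s\<^sub>1 y\<^sub>1"
    using bounds by (simp add: step_bounds_def)
  from half_step(4)[OF this b carriers(1,4) order_refl small_\<omega>(2)]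
  have y1: "norm2 (transpose_mat U *\<^sub>v y\<^sub>1) \<le>
      e * norm2 (transpose_mat U *\<^sub>v b) + \<epsilon> * (N + 1 / 5) * \<beta>" .
  define x where "x = \<epsilon> * \<beta>"
  have x: "0 < x"
    using \<epsilon> \<beta> by (simp add: x_def)
  have "e * norm2 (transpose_mat U *\<^sub>v b) \<le> e * ((1 + \<tau>) * \<beta>)"
  proof (rule mult_left_mono[OF _ e_nonneg])
    have "(1 + e) * \<beta> \<le> (1 + \<tau>) * \<beta>"
      using small_e \<beta> by (intro mult_right_mono) auto
    then show "norm2 (transpose_mat U *\<^sub>v b) \<le> (1 + \<tau>) * \<beta>"
      using norm2_transpose_near_isometry_le[OF U defect b] by linarith
  qed
  also have "\<dots> = f * x + (\<tau> * f) * x"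
    by (simp add: e_f x_def algebra_simps)
  also have "(\<tau> * f) * x \<le> (1 / 20) * x"
    using f x by (intro mult_right_mono) auto
  finally have 1: "e * norm2 (transpose_mat U *\<^sub>v b) \<le> f * x + 1 / 20 * x"
    by simp
  have 2: "norm2 (transpose_mat U *\<^sub>v z) \<le> 105 / 100 * x"
  proof -
    have "norm2 (transpose_mat U *\<^sub>v z) \<le> (1 + e) * norm2 z"
      by (rule norm2_transpose_near_isometry_le[OF U defect z(1)])
    also have "\<dots> \<le> (101 / 100) * (\<epsilon> * ((102 / 100) * \<beta>))"
    proof (rule mult_mono)
      have "(1 + 2 * \<tau>) * \<beta> \<le> (102 / 100) * \<beta>"
        using \<tau> \<beta> by (intro mult_right_mono) auto
      then have "\<epsilon> * norm2 y\<^sub>1 \<le> \<epsilon> * ((102 / 100) * \<beta>)"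
        using norm_y1 \<epsilon> by (intro mult_left_mono) auto
      then show "norm2 z \<le> \<epsilon> * ((102 / 100) * \<beta>)"
        using z(2) by linarith
    qed (use small_e \<tau> in auto)
    also have "\<dots> \<le> 105 / 100 * x"
      using x by (simp add: x_def)
    finally show ?thesis .
  qed
  have "r\<^sub>1 * t = norm2 (transpose_mat U *\<^sub>v (r\<^sub>1 \<cdot>\<^sub>v q\<^sub>1))"
  proof -
    have "transpose_mat U *\<^sub>v (r\<^sub>1 \<cdot>\<^sub>v q\<^sub>1) = r\<^sub>1 \<cdot>\<^sub>v (transpose_mat U *\<^sub>v q\<^sub>1)"
      using U carriers(5) by (intro mult_mat_vec) auto
    then show ?thesis
      using r1_bounds(1) by (simp add: norm2_smult)
  qed
  also have "transpose_mat U *\<^sub>v (r\<^sub>1 \<cdot>\<^sub>v q\<^sub>1) = transpose_mat U *\<^sub>v y\<^sub>1 + transpose_mat U *\<^sub>v z"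
    unfolding z(3) using U carriers(4) z(1) by (intro mult_add_distrib_mat_vec) auto
  also have "norm2 \<dots> \<le> norm2 (transpose_mat U *\<^sub>v y\<^sub>1) + norm2 (transpose_mat U *\<^sub>v z)"
    using U carriers(4) z(1) by (intro norm2_add_le[of _ k]) auto
  also have "\<dots> \<le> f * x + N * x + 2 * x"
  proof -
    have "\<epsilon> * (N + 1 / 5) * \<beta> = N * x + 1 / 5 * x"
      by (simp add: x_def algebra_simps)
    then show ?thesis
      using y1 1 2 x by linarith
  qed
  also have "\<dots> = \<epsilon> * \<beta> * (f + N + 2)"
    by (simp add: x_def algebra_simps)
  finally show ?thesis .
qed

text \<open>Replacing \<open>val_rb v\<close> by \<open>r\<^sub>2 * r\<^sub>1\<close> costs at most
  2 \<epsilon> \<open>\<beta>\<close>, which the summand 2 g in \<open>F\<close> pays for. What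
  remains dominates the bound for \<open>r\<^sub>1 * t\<close>, and the positive factor
  \<open>r\<^sub>1\<close> cancels. In the iteration \<open>F\<close> is \<open>f_sing\<close> and
  \<open>g\<close> is \<open>\<gamma>\<^sub>C\<close>, both at k + 1.\<close>

lemma large_rb:
  assumes e_f: "e = \<epsilon> * f" and f: "0 \<le> f" "\<tau> * f \<le> 1 / 20" and g: "0 < g"
    and large: "\<epsilon> * F * \<beta> \<le> g * \<bar>val_rb v\<bar>" and F: "f + N + 2 + 2 * g \<le> F"
  shows "0 < r\<^sub>1" and "t \<le> g * r\<^sub>2"
proof -
  obtain \<delta>r where \<delta>r: "val_rb v + \<delta>r = r\<^sub>2 * r\<^sub>1" "\<bar>\<delta>r\<bar> \<le> \<epsilon> * \<beta> + \<omega>"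
    using bounds unfolding step_bounds_def by auto
  define x where "x = \<epsilon> * \<beta>"
  have x: "0 < x"
    using \<epsilon> \<beta> by (simp add: x_def)
  have "\<tau> * x \<le> 1 * x"
    using \<tau> x by (intro mult_right_mono) auto
  with small_\<omega>(2) have "\<omega> \<le> x"
    by (simp add: x_def mult.assoc)
  then have "\<bar>val_rb v\<bar> - 2 * x \<le> r\<^sub>2 * r\<^sub>1"
    using \<delta>r r1_bounds(1) r2_near_projection(1) mult_nonneg_nonneg[of r\<^sub>2 r\<^sub>1]
    unfolding x_def[symmetric] by linarith
  then have "g * (\<bar>val_rb v\<bar> - 2 * x) \<le> g * (r\<^sub>2 * r\<^sub>1)"
    using g by (intro mult_left_mono) auto
  then have "F * x - 2 * g * x \<le> g * (r\<^sub>2 * r\<^sub>1)"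
    using large by (simp add: x_def algebra_simps)
  moreover have "(f + N + 2 + 2 * g) * x \<le> F * x"
    using F x by (intro mult_right_mono) auto
  ultimately have lower: "(f + N + 2) * x \<le> g * (r\<^sub>2 * r\<^sub>1)"
    by (simp add: algebra_simps)
  moreover have "0 < (f + N + 2) * x"
    using f N_ge_1 x by simp
  ultimately have "g * (r\<^sub>2 * r\<^sub>1) \<noteq> 0"
    by linarith
  then show r1: "0 < r\<^sub>1"
    using r1_bounds(1) by (cases "r\<^sub>1 = 0") auto
  have "r\<^sub>1 * t \<le> r\<^sub>1 * (g * r\<^sub>2)"
    using first_coefficient[OF e_f f] lower by (simp add: x_def algebra_simps)
  with r1 show "t \<le> g * r\<^sub>2"
    by simp
qed

text \<open>Here the two alternative criteria of the theorem merge. The slightly larger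
  \<open>g'\<close> makes room for the error in near-Pythagoras; in the iteration \<open>g\<close>
  and \<open>g'\<close> are \<open>\<gamma>\<^sub>C\<close> at k + 1 and at k.\<close>

lemma large_r2:
  assumes "0 \<le> g" "g\<^sup>2 \<le> 1 / 2" "g \<le> g'" "40 * \<tau> \<le> g'\<^sup>2 - g\<^sup>2"
    and "(0 < r\<^sub>1 \<and> t \<le> g * r\<^sub>2) \<or> 1 / sqrt (1 + g\<^sup>2) \<le> \<bar>r\<^sub>2\<bar>"
  shows "t \<le> g' * r\<^sub>2" and "1 / 2 \<le> r\<^sub>2\<^sup>2"
proof -
  have r0: "0 \<le> r\<^sub>2"
    by (rule r2_near_projection)
  have "t \<le> g' * r\<^sub>2 \<and> 1 / 2 \<le> r\<^sub>2\<^sup>2"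
    using assms(5)
  proof
    assume small: "0 < r\<^sub>1 \<and> t \<le> g * r\<^sub>2"
    then have "t\<^sup>2 \<le> (g * r\<^sub>2)\<^sup>2"
      by (intro power_mono) auto
    also have "\<dots> \<le> 1 / 2 * r\<^sub>2\<^sup>2"
      unfolding power_mult_distrib using assms(2) by (intro mult_right_mono) auto
    \<comment> \<open>The energy gives 3/2 \<open>r\<^sub>2\<^sup>2\<close> at least 1 - 20 \<tau>,
      hence at least 4/5.\<close>
    finally have "1 / 2 \<le> r\<^sub>2\<^sup>2"
      using energy_lower small \<tau> by linarith
    moreover have "g * r\<^sub>2 \<le> g' * r\<^sub>2"
      using assms(3) r0 by (intro mult_right_mono)
    ultimately show ?thesis
      using small by linarith
  next
    assume large: "1 / sqrt (1 + g\<^sup>2) \<le> \<bar>r\<^sub>2\<bar>"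
    have "(1 / sqrt (1 + g\<^sup>2))\<^sup>2 \<le> \<bar>r\<^sub>2\<bar>\<^sup>2"
      using large by (intro power_mono) auto
    moreover have "0 < 1 + g\<^sup>2"
      by (simp add: add_pos_nonneg)
    ultimately have r2: "1 \<le> (1 + g\<^sup>2) * r\<^sub>2\<^sup>2"
      by (simp add: power_divide field_simps)
    moreover have "(1 + g\<^sup>2) * r\<^sub>2\<^sup>2 \<le> 2 * r\<^sub>2\<^sup>2"
      using assms(2) by (intro mult_right_mono) auto
    ultimately have half: "1 / 2 \<le> r\<^sub>2\<^sup>2"
      by linarith
    have "t\<^sup>2 \<le> g\<^sup>2 * r\<^sub>2\<^sup>2 + 20 * \<tau>"
      using energy_upper r2 by (simp add: algebra_simps)
    \<comment> \<open>The additive error is made proportional to \<open>r\<^sub>2\<^sup>2\<close>,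
      so that the gap between \<open>g\<^sup>2\<close> and \<open>g'\<^sup>2\<close> can absorb
      it.\<close>
    also have "20 * \<tau> \<le> (40 * \<tau>) * r\<^sub>2\<^sup>2"
      using half \<tau> by simp
    also have "\<dots> \<le> (g'\<^sup>2 - g\<^sup>2) * r\<^sub>2\<^sup>2"
      using assms(4) by (intro mult_right_mono) auto
    finally have "t\<^sup>2 \<le> (g' * r\<^sub>2)\<^sup>2"
      by (simp add: power_mult_distrib algebra_simps)
    then have "t \<le> g' * r\<^sub>2"
      by (rule power2_le_imp_le) (use assms(1,3) r0 in simp)
    with half show ?thesis
      by simp
  qed
  then show "t \<le> g' * r\<^sub>2" "1 / 2 \<le> r\<^sub>2\<^sup>2"
    by auto
qed

text \<open>Apply U^T to \<open>r\<^sub>2 \<cdot>\<^sub>v q\<^sub>b = y\<^sub>2 + z\<close> and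
  divide by \<open>r\<^sub>2\<close>. The old defect is damped by t / \<open>r\<^sub>2\<close>, at
  most g; the half-step error grows by at most \<open>sqrt 2\<close>, as
  \<open>r\<^sub>2\<^sup>2\<close> is at least 1/2; the normalization adds at most 2.\<close>

lemma new_column_orthogonal:
  assumes e_f: "e = \<epsilon> * f" and f: "0 \<le> f" and t: "t \<le> g * r\<^sub>2" and r2: "1 / 2 \<le> r\<^sub>2\<^sup>2"
  shows "norm2 (transpose_mat U *\<^sub>v q\<^sub>b) \<le> \<epsilon> * (f * g + sqrt 2 * (N + 1 / 2) + 2)"
proof -
  have r0: "0 < r\<^sub>2"
    using r2_near_projection(1) r2 by (cases "r\<^sub>2 = 0") auto
  have "1 \<le> (sqrt 2 * r\<^sub>2)\<^sup>2"
    using r2 by (simp add: power_mult_distrib)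
  then have "1\<^sup>2 \<le> (sqrt 2 * r\<^sub>2)\<^sup>2"
    by simp
  then have sqrt2: "1 \<le> sqrt 2 * r\<^sub>2"
    by (rule power2_le_imp_le) (use r0 in simp)
  obtain z where z: "z \<in> carrier_vec m" "norm2 z \<le> \<epsilon> * norm2 y\<^sub>2" "r\<^sub>2 \<cdot>\<^sub>v q\<^sub>b = y\<^sub>2 + z"
    using normalizedE[OF normalized_y(2) carriers(6) \<delta>_le(1,2)] by blast
  have "norm2 (transpose_mat U *\<^sub>v z) \<le> (1 + e) * norm2 z"
    by (rule norm2_transpose_near_isometry_le[OF U defect z(1)])
  \<comment> \<open>The factor 1 - \<tau> is kept because
    \<open>(1 - \<tau>) * norm2 y\<^sub>2\<close> is a lower bound for
    \<open>r\<^sub>2\<close>.\<close>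
  also have "\<dots> \<le> (2 * (1 - \<tau>)) * (\<epsilon> * norm2 y\<^sub>2)"
    using small_e \<tau> z(2) by (intro mult_mono) auto
  also have "\<dots> = 2 * \<epsilon> * ((1 - \<tau>) * norm2 y\<^sub>2)"
    by simp
  also have "\<dots> \<le> 2 * \<epsilon> * r\<^sub>2"
    using r2_near_projection(2) \<epsilon> by (intro mult_left_mono) auto
  finally have 1: "norm2 (transpose_mat U *\<^sub>v z) \<le> 2 * \<epsilon> * r\<^sub>2" .
  have "\<epsilon> * f * t \<le> \<epsilon> * f * (g * r\<^sub>2)"
    using t f \<epsilon> by (intro mult_left_mono) auto
  moreover have "\<epsilon> * (N + 1 / 2) * 1 \<le> \<epsilon> * (N + 1 / 2) * (sqrt 2 * r\<^sub>2)"
    using sqrt2 \<epsilon> N_ge_1 by (intro mult_left_mono) auto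
  ultimately have 2: "norm2 (transpose_mat U *\<^sub>v y\<^sub>2) \<le>
      \<epsilon> * f * (g * r\<^sub>2) + \<epsilon> * (N + 1 / 2) * (sqrt 2 * r\<^sub>2)"
    using half_step_q1(3) unfolding e_f by linarith
  have "r\<^sub>2 * norm2 (transpose_mat U *\<^sub>v q\<^sub>b) = norm2 (transpose_mat U *\<^sub>v (r\<^sub>2 \<cdot>\<^sub>v q\<^sub>b))"
  proof -
    have "transpose_mat U *\<^sub>v (r\<^sub>2 \<cdot>\<^sub>v q\<^sub>b) = r\<^sub>2 \<cdot>\<^sub>v (transpose_mat U *\<^sub>v q\<^sub>b)"
      using U carriers(7) by (intro mult_mat_vec) auto
    then show ?thesis
      using r0 by (simp add: norm2_smult)
  qed
  also have "transpose_mat U *\<^sub>v (r\<^sub>2 \<cdot>\<^sub>v q\<^sub>b) = transpose_mat U *\<^sub>v y\<^sub>2 + transpose_mat U *\<^sub>v z"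
    unfolding z(3) using U carriers(6) z(1) by (intro mult_add_distrib_mat_vec) auto
  also have "norm2 \<dots> \<le> norm2 (transpose_mat U *\<^sub>v y\<^sub>2) + norm2 (transpose_mat U *\<^sub>v z)"
    using U carriers(6) z(1) by (intro norm2_add_le[of _ k]) auto
  also have "\<dots> \<le> r\<^sub>2 * (\<epsilon> * (f * g + sqrt 2 * (N + 1 / 2) + 2))"
  proof -
    have "r\<^sub>2 * (\<epsilon> * (f * g + sqrt 2 * (N + 1 / 2) + 2)) =
        \<epsilon> * f * (g * r\<^sub>2) + \<epsilon> * (N + 1 / 2) * (sqrt 2 * r\<^sub>2) + 2 * \<epsilon> * r\<^sub>2"
      by (simp add: algebra_simps)
    then show ?thesis
      using 1 2 by linarith
  qed
  finally show ?thesis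
    using r0 by simp
qed

end

section \<open>The constants\<close>

lemma alpha_sq: "\<alpha>\<^sub>C\<^sup>2 = 7 + 4 * sqrt 2"
  by (simp add: \<alpha>\<^sub>C_def)

lemma gamma_radicand_ge_1: "1 \<le> k \<Longrightarrow> 1 \<le> \<alpha>\<^sub>C\<^sup>2 * (real k - 1) + 1"
  by simp

lemma gamma_radicand_pos:
  assumes "1 \<le> k"
  shows "0 < \<alpha>\<^sub>C\<^sup>2 * (real k - 1) + 1"
  using gamma_radicand_ge_1[OF assms] by linarith

lemma gamma_sq: "1 \<le> k \<Longrightarrow> (\<gamma>\<^sub>C k)\<^sup>2 = 1 / (\<alpha>\<^sub>C\<^sup>2 * (real k - 1) + 1)"
  using gamma_radicand_pos[of k] by (simp add: \<gamma>\<^sub>C_def power_divide)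

lemma gamma_pos: "1 \<le> k \<Longrightarrow> 0 < \<gamma>\<^sub>C k"
  using gamma_radicand_pos[of k] by (simp add: \<gamma>\<^sub>C_def)

lemma gamma_le_1:
  assumes "1 \<le> k"
  shows "\<gamma>\<^sub>C k \<le> 1"
proof -
  have "1 / sqrt r \<le> 1" if "1 \<le> r" for r :: real
    using that by simp
  from this[OF gamma_radicand_ge_1[OF assms]] show ?thesis
    by (simp only: \<gamma>\<^sub>C_def)
qed

text \<open>The strict decrease is the gap from which the tolerance \<tau> of a step is
  taken.\<close>

lemma gamma_Suc_sq_less:
  assumes "1 \<le> k"
  shows "(\<gamma>\<^sub>C (Suc k))\<^sup>2 < (\<gamma>\<^sub>C k)\<^sup>2"
proof -
  have "0 < \<alpha>\<^sub>C\<^sup>2"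
    by (simp add: alpha_sq add_pos_nonneg)
  then have "\<alpha>\<^sub>C\<^sup>2 * (real k - 1) + 1 < \<alpha>\<^sub>C\<^sup>2 * (real (Suc k) - 1) + 1"
    by simp
  then have "1 / (\<alpha>\<^sub>C\<^sup>2 * (real (Suc k) - 1) + 1) < 1 / (\<alpha>\<^sub>C\<^sup>2 * (real k - 1) + 1)"
    using gamma_radicand_pos[OF assms] gamma_radicand_pos[of "Suc k"]
    by (intro divide_strict_left_mono mult_pos_pos) simp_all
  then show ?thesis
    using assms by (simp only: gamma_sq le_SucI)
qed

lemma gamma_Suc_le: "1 \<le> k \<Longrightarrow> \<gamma>\<^sub>C (Suc k) \<le> \<gamma>\<^sub>C k"
  using gamma_Suc_sq_less[of k] gamma_pos[of k] by (metis less_imp_le power2_le_imp_le)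

lemma gamma_Suc_sq_le:
  assumes "1 \<le> k"
  shows "(\<gamma>\<^sub>C (Suc k))\<^sup>2 \<le> 1 / 2"
proof -
  have "7 * 1 \<le> \<alpha>\<^sub>C\<^sup>2 * real k"
    using assms by (intro mult_mono) (auto simp: alpha_sq)
  then have "2 \<le> \<alpha>\<^sub>C\<^sup>2 * real k + 1"
    by linarith
  then have "1 / (\<alpha>\<^sub>C\<^sup>2 * real k + 1) \<le> 1 / 2"
    by (intro divide_left_mono) auto
  then show ?thesis
    by (simp add: gamma_sq)
qed

lemma f1_eq: "f\<^sub>1 m k = sqrt (\<alpha>\<^sub>C\<^sup>2 * (real k - 1) + 1) * L\<^sub>F m k"
  by (simp add: f\<^sub>1_def \<gamma>\<^sub>C_def)

lemma L_ge: "real m + 4 \<le> L\<^sub>F m k"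
  by (simp add: L\<^sub>F_def)

lemma L_mono: "k \<le> l \<Longrightarrow> L\<^sub>F m k \<le> L\<^sub>F m l"
  by (simp add: L\<^sub>F_def mult_mono)

lemma f1_nonneg: "1 \<le> k \<Longrightarrow> 0 \<le> f\<^sub>1 m k"
  using gamma_radicand_ge_1[of k] L_ge[of m k] by (simp add: f1_eq)

lemma f1_1: "f\<^sub>1 m 1 = 2 * real m + 5"
  by (simp add: f1_eq L\<^sub>F_def)

text \<open>As \<open>L\<^sub>F\<close> grows with k, the left radicand is at most (alpha^2 (k - 1)
  + 1) L^2 plus (2 (1 + sqrt 2)^2 + 1) L^2, where L is \<open>L\<^sub>F m (Suc k)\<close>. The
  second coefficient is exactly alpha^2, which raises k - 1 to k.\<close>

lemma f1_Suc:
  assumes k: "1 \<le> k"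
  shows "sqrt ((f\<^sub>1 m k)\<^sup>2 + 2 * ((1 + sqrt 2) * L\<^sub>F m (Suc k))\<^sup>2 + (L\<^sub>F m (Suc k))\<^sup>2) \<le> f\<^sub>1 m (Suc k)"
proof (rule real_le_lsqrt)
  show "0 \<le> f\<^sub>1 m (Suc k)"
    by (simp add: f1_nonneg)
  define L where "L = L\<^sub>F m (Suc k)"
  have "(L\<^sub>F m k)\<^sup>2 \<le> L\<^sup>2"
    unfolding L_def using L_mono[of k "Suc k" m] L_ge[of m k] by (intro power_mono) auto
  then have "(f\<^sub>1 m k)\<^sup>2 \<le> (\<alpha>\<^sub>C\<^sup>2 * (real k - 1) + 1) * L\<^sup>2"
    unfolding f1_eq power_mult_distrib using gamma_radicand_ge_1[OF k]
    by (simp add: mult_left_mono)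
  moreover have "2 * ((1 + sqrt 2) * L)\<^sup>2 + L\<^sup>2 = (7 + 4 * sqrt 2) * L\<^sup>2"
    by (simp add: power2_eq_square algebra_simps)
  then have "2 * ((1 + sqrt 2) * L)\<^sup>2 + L\<^sup>2 = \<alpha>\<^sub>C\<^sup>2 * L\<^sup>2"
    by (simp only: alpha_sq)
  moreover have "(f\<^sub>1 m (Suc k))\<^sup>2 = (\<alpha>\<^sub>C\<^sup>2 * (real k - 1) + 1) * L\<^sup>2 + \<alpha>\<^sub>C\<^sup>2 * L\<^sup>2"
    unfolding f1_eq power_mult_distrib by (simp add: L_def algebra_simps)
  ultimately show "(f\<^sub>1 m k)\<^sup>2 + 2 * ((1 + sqrt 2) * L\<^sub>F m (Suc k))\<^sup>2 + (L\<^sub>F m (Suc k))\<^sup>2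
      \<le> (f\<^sub>1 m (Suc k))\<^sup>2"
    unfolding L_def by linarith
qed

text \<open>The left side is the budget required by \<open>large_rb\<close>. With L =
  \<open>L\<^sub>F m (Suc k)\<close>, \<open>f_sing\<close> splits into L divided by
  \<open>\<gamma>\<^sub>C (Suc k)\<close>, which dominates \<open>f\<^sub>1 m k\<close>; L itself,
  which dominates N + 2; and 2, which dominates the gamma term.\<close>

lemma f_sing_Suc:
  assumes k: "1 \<le> k"
  shows "f\<^sub>1 m k + (sqrt k * (real m + real k) + 1) + 2 + 2 * \<gamma>\<^sub>C (Suc k) \<le> f_sing m (Suc k)"
proof -
  define r where "r = sqrt (\<alpha>\<^sub>C\<^sup>2 * (real (Suc k) - 1) + 1)"
  have "f\<^sub>1 m k \<le> r * L\<^sub>F m (Suc k)"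
    unfolding f1_eq r_def using L_mono[of k "Suc k" m] L_ge[of m k]
    by (intro mult_mono) (auto simp: mult_left_mono alpha_sq)
  moreover have "sqrt k * (real m + real k) + 3 \<le> L\<^sub>F m (Suc k)"
    using L_mono[of k "Suc k" m] by (simp add: L\<^sub>F_def)
  moreover have "f_sing m (Suc k) = r * L\<^sub>F m (Suc k) + L\<^sub>F m (Suc k) + 2"
    unfolding f_sing_def r_def L\<^sub>F_def by (simp add: distrib_right)
  ultimately show ?thesis
    using gamma_le_1[of "Suc k"] by linarith
qed

text \<open>The product of \<open>f\<^sub>1\<close> and \<open>\<gamma>\<^sub>C\<close> at the same
  k is \<open>L\<^sub>F m k\<close>. The half-step term fits under
  \<open>sqrt 2 * L\<^sub>F m k\<close> since \<open>L\<^sub>F\<close> exceeds N + 1/2 by m +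
  5/2.\<close>

lemma new_column_bound:
  assumes k: "1 \<le> k"
  shows "f\<^sub>1 m k * \<gamma>\<^sub>C k + sqrt 2 * (sqrt k * (real m + real k) + 1 + 1 / 2) + 2
      \<le> (1 + sqrt 2) * L\<^sub>F m (Suc k)"
proof -
  have "f\<^sub>1 m k * \<gamma>\<^sub>C k = L\<^sub>F m k"
    using gamma_pos[OF k] by (simp add: f\<^sub>1_def)
  moreover have "sqrt 2 * (sqrt k * (real m + real k) + 1 + 1 / 2) + 2 \<le> sqrt 2 * L\<^sub>F m k"
  proof -
    have "1 \<le> sqrt (2 :: real)"
      by simp
    moreover have "sqrt 2 * 2 \<le> sqrt 2 * (L\<^sub>F m k - (sqrt k * (real m + real k) + 1 + 1 / 2))"
      by (intro mult_left_mono) (auto simp: L\<^sub>F_def)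
    ultimately show ?thesis
      unfolding right_diff_distrib by linarith
  qed
  moreover have "(1 + sqrt 2) * L\<^sub>F m k \<le> (1 + sqrt 2) * L\<^sub>F m (Suc k)"
    by (intro mult_left_mono L_mono) auto
  ultimately show ?thesis
    by (simp add: distrib_right)
qed

section \<open>The whole iteration\<close>

text \<open>A second-order term eventually falls below any positive multiple of \<epsilon>. This
  lets slack in the first-order constants swallow all remainders.\<close>

lemma O_sq_eventually_le:
  assumes \<omega>: "\<omega> \<in> O_sq" and c: "0 < c"
  shows "\<forall>\<^sub>F \<epsilon> in at_right 0. \<omega> \<epsilon> \<le> c * \<epsilon>"
proof -
  obtain C where C: "C > 0" "\<forall>\<^sub>F \<epsilon> in at_right 0. norm (\<omega> \<epsilon>) \<le> C * norm (\<epsilon>\<^sup>2)"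
    using landau_o.bigE[OF \<omega>] by blast
  have "\<forall>\<^sub>F \<epsilon> in at_right 0. \<epsilon> \<in> {0<..<c / C}"
    using c C by (intro eventually_at_right_real) simp
  with C(2) show ?thesis
  proof eventually_elim
    case (elim \<epsilon>)
    then have "C * \<epsilon> * \<epsilon> \<le> c * \<epsilon>"
      using C(1) by (intro mult_right_mono) (auto simp: field_simps)
    moreover have "\<omega> \<epsilon> \<le> C * \<epsilon> * \<epsilon>"
      using elim by (simp add: power2_eq_square mult.assoc)
    ultimately show ?case
      by linarith
  qed
qed

lemma eventually_mult_le_at_right_0:
  fixes K c :: real
  assumes "0 < c"
  shows "\<forall>\<^sub>F \<epsilon> in at_right 0. K * \<epsilon> \<le> c"
proof -
  have "\<forall>\<^sub>F \<epsilon> in at_right 0. \<epsilon> \<in> {0<..<c / (\<bar>K\<bar> + 1)}"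
    using assms by (intro eventually_at_right_real) (simp add: add_nonneg_pos)
  then show ?thesis
  proof eventually_elim
    case (elim \<epsilon>)
    then have "(\<bar>K\<bar> + 1) * \<epsilon> \<le> c"
      by (simp add: field_simps add_nonneg_pos)
    moreover have "K * \<epsilon> \<le> (\<bar>K\<bar> + 1) * \<epsilon>"
      using elim by (intro mult_right_mono) auto
    ultimately show ?case
      by linarith
  qed
qed

lemma normalized_mono:
  assumes "normalized \<epsilon> \<omega> y r q" "\<omega> \<le> \<omega>'"
  shows "normalized \<epsilon> \<omega>' y r q"
  using assms unfolding normalized_def Let_def by fastforce

lemma half_step_bounds_mono:
  assumes "half_step_bounds \<epsilon> \<omega> U c s y" "\<omega> \<le> \<omega>'"
  shows "half_step_bounds \<epsilon> \<omega>' U c s y"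
proof -
  have "x \<le> a + \<omega>'" if "x \<le> a + \<omega>" for x a
    using that assms(2) by linarith
  with assms(1) show ?thesis
    unfolding half_step_bounds_def Let_def by blast
qed

lemma step_bounds_mono:
  assumes "step_bounds \<epsilon> \<omega> U b v" "\<omega> \<le> \<omega>'"
  shows "step_bounds \<epsilon> \<omega>' U b v"
proof -
  have "x \<le> a + \<omega>'" if "x \<le> a + \<omega>" for x a
    using that assms(2) by linarith
  with assms half_step_bounds_mono show ?thesis
    unfolding step_bounds_def by blast
qed

lemma first_cols_carrier: "Q \<in> carrier_mat m n \<Longrightarrow> first_cols k Q \<in> carrier_mat m k"
  by (simp add: first_cols_def)

lemma col_first_cols:
  "Q \<in> carrier_mat m n \<Longrightarrow> j < k \<Longrightarrow> k \<le> n \<Longrightarrow> col (first_cols k Q) j = col Q j"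
  by (intro eq_vecI) (auto simp: first_cols_def)

lemma first_cols_all: "Q \<in> carrier_mat m n \<Longrightarrow> first_cols n Q = Q"
  by (intro eq_matI) (auto simp: first_cols_def)

text \<open>Entries of \<open>R\<close> below the diagonal vanish, so column j of the product
  involves only columns 0 to j of \<open>Q\<close>; the last of them is split off to match the
  output of a step.\<close>

lemma col_mult_upper_triangular:
  fixes Q R :: "real mat"
  assumes Q: "Q \<in> carrier_mat m n" and R: "R \<in> carrier_mat n n" "upper_triangular R" and j: "j < n"
  shows "col (Q * R) j = first_cols j Q *\<^sub>v vec j (\<lambda>i. R $$ (i, j)) + R $$ (j, j) \<cdot>\<^sub>v col Q j"
proof (rule eq_vecI)
  fix i assume "i < dim_vec (first_cols j Q *\<^sub>v vec j (\<lambda>i. R $$ (i, j)) + R $$ (j, j) \<cdot>\<^sub>v col Q j)"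
  then have i: "i < m"
    using Q by simp
  have "(\<Sum>l<n. Q $$ (i, l) * R $$ (l, j)) = (\<Sum>l<Suc j. Q $$ (i, l) * R $$ (l, j))"
    using R j upper_triangularD[OF R(2)] by (intro sum.mono_neutral_right) auto
  then show "col (Q * R) j $ i =
      (first_cols j Q *\<^sub>v vec j (\<lambda>i. R $$ (i, j)) + R $$ (j, j) \<cdot>\<^sub>v col Q j) $ i"
    using i j Q R by (simp add: scalar_prod_def atLeast0LessThan first_cols_def)
qed (use Q in \<open>auto simp: first_cols_def\<close>)

text \<open>Step k + 1 of the text takes k columns as input and produces the column of index k; this
  form removes the shift.\<close>

lemma cgs2_skeleton_step:
  assumes skeleton: "cgs2_skeleton m n Q R v" and k: "1 \<le> k" "k < n"
  shows "vals_shape m k (v (Suc k))" and "col Q k = val_qb (v (Suc k))"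
    and "R $$ (k, k) = val_rb (v (Suc k))" and "\<forall>i < k. R $$ (i, k) = val_sb (v (Suc k)) $ i"
proof -
  have "Suc k \<in> {2..n}"
    using k by simp
  with skeleton have "vals_shape m (Suc k - 1) (v (Suc k)) \<and>
      col Q (Suc k - 1) = val_qb (v (Suc k)) \<and>
      R $$ (Suc k - 1, Suc k - 1) = val_rb (v (Suc k)) \<and>
      (\<forall>i < Suc k - 1. R $$ (i, Suc k - 1) = val_sb (v (Suc k)) $ i)"
    unfolding cgs2_skeleton_def by blast
  then show "vals_shape m k (v (Suc k))" "col Q k = val_qb (v (Suc k))"
    "R $$ (k, k) = val_rb (v (Suc k))" "\<forall>i < k. R $$ (i, k) = val_sb (v (Suc k)) $ i"
    by simp_all
qed

locale cgs2 =
  fixes m n :: nat and A :: "real mat" and Q R :: "real \<Rightarrow> real mat" and v :: "real \<Rightarrow> nat \<Rightarrow> cgs2_vals"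
  assumes n: "1 \<le> n" and nm: "n \<le> m" and A: "A \<in> carrier_mat m n"
    and rank: "vec_space.rank m A = n" and computes: "cgs2_computes m n A Q R v"
begin

lemma norm_col_pos:
  assumes "j < n"
  shows "0 < norm2 (col A j)"
proof -
  have "norm2 (col A j) \<noteq> 0"
    using full_rank_col_nonzero[OF A rank assms] A by (simp add: norm2_eq_0_iff)
  then show ?thesis
    by (simp add: less_le)
qed

lemma skeleton: "\<forall>\<^sub>F \<epsilon> in at_right 0. cgs2_skeleton m n (Q \<epsilon>) (R \<epsilon>) (v \<epsilon>)"
  using computes by (simp add: cgs2_computes_def)

definition gram_defect :: "nat \<Rightarrow> real \<Rightarrow> real" where
  "gram_defect k \<epsilon> =
     spec_norm (1\<^sub>m k - transpose_mat (first_cols k (Q \<epsilon>)) * first_cols k (Q \<epsilon>))"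

lemma near_orthonormal_iff:
  assumes "Q \<epsilon> \<in> carrier_mat m n"
  shows "near_orthonormal \<epsilon> \<omega> (first_cols k (Q \<epsilon>)) \<longleftrightarrow>
    gram_defect k \<epsilon> \<le> \<epsilon> * f\<^sub>1 m k + \<omega> \<and> \<epsilon> * f\<^sub>1 m k + \<omega> < 1"
  using assms first_cols_carrier[OF assms, of k]
  by (simp add: near_orthonormal_def Let_def gram_defect_def)

lemma eventually_first_normalized:
  assumes "0 < c"
  shows "\<forall>\<^sub>F \<epsilon> in at_right 0. normalized \<epsilon> (c * \<epsilon>) (col A 0) (R \<epsilon> $$ (0, 0)) (col (Q \<epsilon>) 0)"
proof -
  obtain \<omega> where "\<omega> \<in> O_sq" and ev: "\<forall>\<^sub>F \<epsilon> in at_right 0.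
      normalized \<epsilon> (\<omega> \<epsilon>) (col A 0) (R \<epsilon> $$ (0, 0)) (col (Q \<epsilon>) 0) \<and>
      (\<forall>k \<in> {2..n}. step_normalized \<epsilon> (\<omega> \<epsilon>) (v \<epsilon> k))"
    using computes unfolding cgs2_computes_def by blast
  from O_sq_eventually_le[OF this(1) assms] ev show ?thesis
    by eventually_elim (auto intro: normalized_mono)
qed

text \<open>\<eta> is fixed first because the remainder supplied by \<open>cgs2_computes\<close>
  depends on it. The bound e is quantified after \<epsilon>, so that it may later be a multiple of
  \<epsilon>.\<close>

lemma eventually_small_step:
  assumes k: "1 \<le> k" "k < n" and \<eta>: "\<eta> \<in> O_sq" and \<tau>: "0 < \<tau>" "\<tau> \<le> 1 / 100"
    and \<tau>N: "\<tau> * (sqrt k * (real m + real k) + 1) \<le> 1 / 20"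
  shows "\<forall>\<^sub>F \<epsilon> in at_right 0. near_orthonormal \<epsilon> (\<eta> \<epsilon>) (first_cols k (Q \<epsilon>)) \<longrightarrow>
    (\<forall>e. gram_defect k \<epsilon> \<le> e \<longrightarrow> e \<le> \<tau> \<longrightarrow>
      small_step m k \<epsilon> (\<tau> * min 1 (norm2 (col A k)) * \<epsilon>) \<tau> e (first_cols k (Q \<epsilon>)) (col A k)
        (v \<epsilon> (Suc k)))"
proof -
  define N where "N = sqrt k * (real m + real k) + 1"
  \<comment> \<open>One rate that meets both conditions on \<omega> in \<open>small_step\<close>,
    the absolute one and the one relative to the column of \<open>A\<close>. It is positive since
    that column is nonzero.\<close>
  define \<mu> where "\<mu> = \<tau> * min 1 (norm2 (col A k))"
  have \<mu>: "0 < \<mu>"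
    using \<tau> norm_col_pos[OF k(2)] by (simp add: \<mu>_def)
  have Suck: "Suc k \<in> {2..n}"
    using k by simp
  obtain \<omega>1 where \<omega>1: "\<omega>1 \<in> O_sq" and ev1: "\<forall>\<^sub>F \<epsilon> in at_right 0.
      normalized \<epsilon> (\<omega>1 \<epsilon>) (col A 0) (R \<epsilon> $$ (0, 0)) (col (Q \<epsilon>) 0) \<and>
      (\<forall>k \<in> {2..n}. step_normalized \<epsilon> (\<omega>1 \<epsilon>) (v \<epsilon> k))"
    using computes unfolding cgs2_computes_def by blast
  obtain \<omega>2 where \<omega>2: "\<omega>2 \<in> O_sq" and ev2: "\<forall>\<^sub>F \<epsilon> in at_right 0.
      near_orthonormal \<epsilon> (\<eta> \<epsilon>) (first_cols (Suc k - 1) (Q \<epsilon>)) \<longrightarrow>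
      step_bounds \<epsilon> (\<omega>2 \<epsilon>) (first_cols (Suc k - 1) (Q \<epsilon>)) (col A (Suc k - 1)) (v \<epsilon> (Suc k))"
    using computes Suck \<eta> unfolding cgs2_computes_def by blast
  have pos: "\<forall>\<^sub>F \<epsilon> in at_right (0 :: real). 0 < \<epsilon>"
    by (rule eventually_at_right_less)
  from ev1 ev2 pos skeleton O_sq_eventually_le[OF \<omega>1 \<mu>] O_sq_eventually_le[OF \<omega>2 \<mu>]
    eventually_mult_le_at_right_0[OF \<tau>(1), of "real m / 2 + 2"]
    eventually_mult_le_at_right_0[OF \<tau>(1), of N]
  show ?thesis
  proof eventually_elim
    case (elim \<epsilon>)
    have QA: "Q \<epsilon> \<in> carrier_mat m n"
      using elim(4) by (simp add: cgs2_skeleton_def)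
    have shape: "vals_shape m k (v \<epsilon> (Suc k))"
      by (rule cgs2_skeleton_step[OF elim(4) k])
    have sn: "step_normalized \<epsilon> (\<mu> * \<epsilon>) (v \<epsilon> (Suc k))"
      using elim(1,5) Suck normalized_mono unfolding step_normalized_def by blast
    have \<mu>_le: "\<mu> * \<epsilon> \<le> \<tau> * \<epsilon>" "\<mu> * \<epsilon> \<le> \<tau> * \<epsilon> * norm2 (col A k)"
    proof -
      have "\<mu> \<le> \<tau> * 1" "\<mu> \<le> \<tau> * norm2 (col A k)"
        unfolding \<mu>_def using \<tau> by (intro mult_left_mono; simp)+
      from this[THEN mult_right_mono, of \<epsilon>] elim(3)
      show "\<mu> * \<epsilon> \<le> \<tau> * \<epsilon>" "\<mu> * \<epsilon> \<le> \<tau> * \<epsilon> * norm2 (col A k)"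
        by (simp_all add: mult_ac)
    qed
    show ?case
    proof (intro impI allI)
      fix e assume near: "near_orthonormal \<epsilon> (\<eta> \<epsilon>) (first_cols k (Q \<epsilon>))"
        and e: "gram_defect k \<epsilon> \<le> e" "e \<le> \<tau>"
      have "step_bounds \<epsilon> (\<mu> * \<epsilon>) (first_cols k (Q \<epsilon>)) (col A k) (v \<epsilon> (Suc k))"
        using elim(2,6) near step_bounds_mono by simp
      then show "small_step m k \<epsilon> (\<tau> * min 1 (norm2 (col A k)) * \<epsilon>) \<tau> e (first_cols k (Q \<epsilon>))
          (col A k) (v \<epsilon> (Suc k))"
        unfolding \<mu>_def[symmetric]
        using A first_cols_carrier[OF QA, of k] shape sn elim(3,7,8) e \<tau> \<tau>N \<mu>_le
          norm_col_pos[OF k(2)]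
        by unfold_locales (auto simp: gram_defect_def N_def mult.commute)
    qed
  qed
qed

section \<open>The residual bound\<close>

text \<open>Column 0 carries only a normalization error; every later column is covered by the
  residual of its step.\<close>

lemma eventually_residual_col:
  assumes \<eta>: "\<eta> \<in> O_sq" and j: "j < n"
  shows "\<forall>\<^sub>F \<epsilon> in at_right 0.
    (\<forall>k \<in> {1..n - 1}. near_orthonormal \<epsilon> (\<eta> \<epsilon>) (first_cols k (Q \<epsilon>))) \<longrightarrow>
    norm2 (col (A - Q \<epsilon> * R \<epsilon>) j) \<le> \<epsilon> * norm2 (col A j) * (15 + 2 * real j * sqrt j)"
proof (cases "j = 0")
  case True
  have pos: "\<forall>\<^sub>F \<epsilon> in at_right (0 :: real). 0 < \<epsilon>"
    by (rule eventually_at_right_less)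
  have half: "0 < 1 / (2 :: real)" and one: "0 < (1 :: real)"
    by auto
  from pos skeleton eventually_first_normalized[OF one]
    eventually_mult_le_at_right_0[OF half, of "real m / 2 + 2"]
  show ?thesis
  proof eventually_elim
    case (elim \<epsilon>)
    have QA: "Q \<epsilon> \<in> carrier_mat m n" and RA: "R \<epsilon> \<in> carrier_mat n n" "upper_triangular (R \<epsilon>)"
      using elim(2) by (auto simp: cgs2_skeleton_def)
    have a: "col A 0 \<in> carrier_vec m"
      using A by auto
    have d: "(real m / 2 + 1) * \<epsilon> + 1 * \<epsilon> \<le> 1 / 2" "1 / 2 < (1 :: real)"
      using elim(4) by (auto simp: algebra_simps)
    obtain z where z: "z \<in> carrier_vec m" "norm2 z \<le> \<epsilon> * norm2 (col A 0)"
        "R \<epsilon> $$ (0, 0) \<cdot>\<^sub>v col (Q \<epsilon>) 0 = col A 0 + z"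
      using normalizedE[OF elim(3) a d] by blast
    have "col (A - Q \<epsilon> * R \<epsilon>) 0 = col A 0 - col (Q \<epsilon> * R \<epsilon>) 0"
      using A QA RA n by (intro eq_vecI) auto
    also have "col (Q \<epsilon> * R \<epsilon>) 0 = col A 0 + z"
      using col_mult_upper_triangular[OF QA RA, of 0] n QA z a
      by (auto simp: first_cols_def scalar_prod_def intro!: eq_vecI)
    also have "col A 0 - (col A 0 + z) = - z"
      using a z(1) by (intro eq_vecI) auto
    finally have "norm2 (col (A - Q \<epsilon> * R \<epsilon>) 0) \<le> \<epsilon> * norm2 (col A 0)"
      using z(2) by simp
    also have "\<dots> \<le> \<epsilon> * norm2 (col A 0) * 15"
      using elim(1) by simp
    finally show ?case
      using True by simp
  qed
next
  case False
  then have k: "1 \<le> j" "j < n"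
    using j by auto
  define N where "N = sqrt j * (real m + real j) + 1"
  have N: "1 \<le> N"
    by (simp add: N_def)
  define \<tau> where "\<tau> = 1 / (100 * N)"
  have \<tau>: "0 < \<tau>" "\<tau> \<le> 1 / 100" "\<tau> * (sqrt j * (real m + real j) + 1) \<le> 1 / 20"
    using N unfolding N_def[symmetric] by (auto simp: \<tau>_def field_simps)
  have pos: "\<forall>\<^sub>F \<epsilon> in at_right (0 :: real). 0 < \<epsilon>"
    by (rule eventually_at_right_less)
  have one: "0 < (1 :: real)"
    by simp
  from pos skeleton eventually_small_step[OF k \<eta> \<tau>] O_sq_eventually_le[OF \<eta> one]
    eventually_mult_le_at_right_0[OF \<tau>(1), of "f\<^sub>1 m j + 1"]
  show ?thesis
  proof eventually_elim
    case (elim \<epsilon>)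
    have QA: "Q \<epsilon> \<in> carrier_mat m n" and RA: "R \<epsilon> \<in> carrier_mat n n" "upper_triangular (R \<epsilon>)"
      using elim(2) by (auto simp: cgs2_skeleton_def)
    note vals = cgs2_skeleton_step(2-4)[OF elim(2) k]
    show ?case
    proof
      assume "\<forall>k \<in> {1..n - 1}. near_orthonormal \<epsilon> (\<eta> \<epsilon>) (first_cols k (Q \<epsilon>))"
      then have near: "near_orthonormal \<epsilon> (\<eta> \<epsilon>) (first_cols j (Q \<epsilon>))"
        using k by auto
      then have "gram_defect j \<epsilon> \<le> \<epsilon> * f\<^sub>1 m j + \<eta> \<epsilon>"
        by (simp add: near_orthonormal_iff[OF QA])
      \<comment> \<open>For the residual the defect only has to be small, so \<tau> itself serves as
        the bound e of the step.\<close>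
      then have "gram_defect j \<epsilon> \<le> \<tau>"
        using elim(4,5) by (simp add: algebra_simps)
      then interpret small_step m j \<epsilon> "\<tau> * min 1 (norm2 (col A j)) * \<epsilon>" \<tau> \<tau> "first_cols j (Q \<epsilon>)"
          "col A j" "v \<epsilon> (Suc j)"
        using elim(3) near by blast
      have "vec j (\<lambda>i. R \<epsilon> $$ (i, j)) = val_sb (v \<epsilon> (Suc j))"
        using vals(3) carriers(3) by (intro eq_vecI) auto
      then have "col (Q \<epsilon> * R \<epsilon>) j = first_cols j (Q \<epsilon>) *\<^sub>v val_sb (v \<epsilon> (Suc j)) +
          val_rb (v \<epsilon> (Suc j)) \<cdot>\<^sub>v val_qb (v \<epsilon> (Suc j))"
        using col_mult_upper_triangular[OF QA RA j] by (simp add: vals)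
      moreover have "col (A - Q \<epsilon> * R \<epsilon>) j = col A j - col (Q \<epsilon> * R \<epsilon>) j"
        using A QA RA j by (intro eq_vecI) auto
      ultimately show "norm2 (col (A - Q \<epsilon> * R \<epsilon>) j) \<le>
          \<epsilon> * norm2 (col A j) * (15 + 2 * real j * sqrt j)"
        using residual by simp
    qed
  qed
qed

lemma eventually_residual:
  assumes \<eta>: "\<eta> \<in> O_sq"
  shows "\<forall>\<^sub>F \<epsilon> in at_right 0.
    (\<forall>k \<in> {1..n - 1}. near_orthonormal \<epsilon> (\<eta> \<epsilon>) (first_cols k (Q \<epsilon>))) \<longrightarrow>
    spec_norm (A - Q \<epsilon> * R \<epsilon>)
      \<le> \<epsilon> * (2 * real m * sqrt (real n) + 2 * (real n)\<^sup>2 + 13 * sqrt (real n)) * spec_norm A"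
proof -
  have "\<forall>\<^sub>F \<epsilon> in at_right 0. \<forall>j \<in> {..<n}.
    (\<forall>k \<in> {1..n - 1}. near_orthonormal \<epsilon> (\<eta> \<epsilon>) (first_cols k (Q \<epsilon>))) \<longrightarrow>
    norm2 (col (A - Q \<epsilon> * R \<epsilon>) j) \<le> \<epsilon> * norm2 (col A j) * (15 + 2 * real j * sqrt j)"
    by (intro eventually_ball_finite ballI eventually_residual_col[OF \<eta>]) auto
  moreover have "\<forall>\<^sub>F \<epsilon> in at_right (0 :: real). 0 < \<epsilon>"
    by (rule eventually_at_right_less)
  ultimately show ?thesis
    using skeleton
  proof eventually_elim
    case (elim \<epsilon>)
    have RA: "R \<epsilon> \<in> carrier_mat n n" and QA: "Q \<epsilon> \<in> carrier_mat m n"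
      using elim(3) by (auto simp: cgs2_skeleton_def)
    show ?case
    proof
      assume near: "\<forall>k \<in> {1..n - 1}. near_orthonormal \<epsilon> (\<eta> \<epsilon>) (first_cols k (Q \<epsilon>))"
      have "spec_norm (A - Q \<epsilon> * R \<epsilon>) \<le>
          sqrt (dim_col (A - Q \<epsilon> * R \<epsilon>)) * (\<epsilon> * spec_norm A * (15 + 2 * real n * sqrt n))"
      proof (rule spec_norm_le_sqrt_mult)
        fix j assume "j < dim_col (A - Q \<epsilon> * R \<epsilon>)"
        then have j: "j < n"
          using RA by simp
        have "norm2 (col (A - Q \<epsilon> * R \<epsilon>) j) \<le> \<epsilon> * norm2 (col A j) * (15 + 2 * real j * sqrt j)"
          using elim(1) near j by blast
        also have "\<dots> \<le> \<epsilon> * spec_norm A * (15 + 2 * real n * sqrt n)"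
          using elim(2) j A norm2_col_le_spec_norm[of j A] spec_norm_nonneg[of A]
          by (intro mult_mono add_mono) auto
        finally show "norm2 (col (A - Q \<epsilon> * R \<epsilon>) j) \<le> \<epsilon> * spec_norm A * (15 + 2 * real n * sqrt n)" .
      qed (use elim(2) spec_norm_nonneg[of A] in auto)
      also have "\<dots> = \<epsilon> * spec_norm A * (15 * sqrt n + 2 * real n * (sqrt n * sqrt n))"
        using RA by (simp add: algebra_simps)
      also have "\<dots> = \<epsilon> * spec_norm A * (15 * sqrt n + 2 * (real n)\<^sup>2)"
        by (simp add: power2_eq_square)
      \<comment> \<open>Of the 15 square roots of n, two are covered by 2 m n^(1/2), as m is at
        least 1.\<close>
      also have "\<dots> \<le> \<epsilon> * spec_norm A * (2 * real m * sqrt (real n) + 2 * (real n)\<^sup>2 + 13 * sqrt (real n))"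
      proof (rule mult_left_mono)
        have "(2 * 1 + 13) * sqrt n \<le> (2 * real m + 13) * sqrt n"
          using n nm by (intro mult_right_mono) auto
        then show "15 * sqrt n + 2 * (real n)\<^sup>2 \<le>
            2 * real m * sqrt (real n) + 2 * (real n)\<^sup>2 + 13 * sqrt (real n)"
          by (simp add: algebra_simps)
      qed (use elim(2) spec_norm_nonneg[of A] in auto)
      finally show "spec_norm (A - Q \<epsilon> * R \<epsilon>)
          \<le> \<epsilon> * (2 * real m * sqrt (real n) + 2 * (real n)\<^sup>2 + 13 * sqrt (real n)) * spec_norm A"
        by (simp add: mult_ac)
    qed
  qed
qed

section \<open>The orthogonality bound\<close>

text \<open>The disjunction is read at a single \<epsilon>, so which criterion holds may change with
  \<epsilon>.\<close>

definition well_separated :: "real \<Rightarrow> bool" where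
  "well_separated \<epsilon> \<longleftrightarrow>
     (\<forall>k \<in> {2..n}. \<epsilon> * f_sing m k * norm2 (col A (k - 1)) \<le> \<gamma>\<^sub>C k * \<bar>R \<epsilon> $$ (k - 1, k - 1)\<bar>) \<or>
     (\<forall>k \<in> {2..n}. \<bar>val_r2 (v \<epsilon> k)\<bar> \<ge> 1 / sqrt (1 + (\<gamma>\<^sub>C k)\<^sup>2))"

text \<open>The base case appends one column to a matrix without columns, whose defect is 0. What
  remains is the deviation of the first column from unit length, and m + 5 is at most
  \<open>f\<^sub>1 m 1 = 2 m + 5\<close>.\<close>

lemma eventually_gram_defect_1: "\<forall>\<^sub>F \<epsilon> in at_right 0. gram_defect 1 \<epsilon> \<le> \<epsilon> * f\<^sub>1 m 1"
proof -
  have pos: "\<forall>\<^sub>F \<epsilon> in at_right (0 :: real). 0 < \<epsilon>"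
    by (rule eventually_at_right_less)
  have c: "0 < 1 / (4 :: real)" "0 < 1 / (8 :: real)"
    by auto
  from pos skeleton eventually_first_normalized[OF c(1)]
    eventually_mult_le_at_right_0[OF c(2), of "(real m + 5)\<^sup>2"]
  show ?thesis
  proof eventually_elim
    case (elim \<epsilon>)
    have QA: "Q \<epsilon> \<in> carrier_mat m n"
      using elim(2) by (auto simp: cgs2_skeleton_def)
    have a: "col A 0 \<in> carrier_vec m" and q: "col (Q \<epsilon>) 0 \<in> carrier_vec m"
      using A QA by auto
    \<comment> \<open>There is no breakdown: the computed norm is at least half of the nonzero norm
      of the first column of \<open>A\<close>.\<close>
    have "R \<epsilon> $$ (0, 0) \<noteq> 0"
    proof -
      have "real m / 2 + 5 / 4 \<le> (real m + 5) * 1"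
        by simp
      also have "\<dots> \<le> (real m + 5) * (real m + 5)"
        by (intro mult_left_mono) auto
      finally have "(real m / 2 + 5 / 4) * \<epsilon> \<le> (real m + 5)\<^sup>2 * \<epsilon>"
        unfolding power2_eq_square using elim(1) by (intro mult_right_mono) auto
      then have d: "(real m / 2 + 1) * \<epsilon> + 1 / 4 * \<epsilon> \<le> 1 / 2" "1 / 2 < (1 :: real)"
        using elim(4) by (auto simp: algebra_simps)
      have "(1 - 1 / 2) * norm2 (col A 0) \<le> R \<epsilon> $$ (0, 0)"
        using normalizedE[OF elim(3) a d] by blast
      then show ?thesis
        using norm_col_pos[of 0] n by simp
    qed
    then have close: "\<bar>1 - (norm2 (col (first_cols 1 (Q \<epsilon>)) 0))\<^sup>2\<bar> \<le> (real m + 5) * \<epsilon>"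
      using norm2_normalized_close[OF elim(3) a q elim(1,4)] col_first_cols[OF QA, of 0 1] n by simp
    have dim0: "norm2 u = 0" if "dim_vec u = 0" for u :: "real vec"
      using that by (simp add: norm2_def)
    have "gram_defect 1 \<epsilon> \<le> sqrt (0\<^sup>2 + 2 * 0\<^sup>2 + ((real m + 5) * \<epsilon>)\<^sup>2)"
      unfolding gram_defect_def One_nat_def
    proof (rule spec_norm_gram_defect_append)
      show "first_cols 0 (Q \<epsilon>) \<in> carrier_mat m 0" "first_cols (Suc 0) (Q \<epsilon>) \<in> carrier_mat m (Suc 0)"
        using first_cols_carrier[OF QA] by auto
      show "spec_norm (1\<^sub>m 0 - transpose_mat (first_cols 0 (Q \<epsilon>)) * first_cols 0 (Q \<epsilon>)) \<le> 0"
        by (rule spec_norm_leI) (simp add: dim0 first_cols_def)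
      show "norm2 (transpose_mat (first_cols 0 (Q \<epsilon>)) *\<^sub>v col (first_cols (Suc 0) (Q \<epsilon>)) 0) \<le> 0"
        by (simp add: dim0 first_cols_def)
      show "\<bar>1 - (norm2 (col (first_cols (Suc 0) (Q \<epsilon>)) 0))\<^sup>2\<bar> \<le> (real m + 5) * \<epsilon>"
        using close by simp
    qed simp
    also have "\<dots> = (real m + 5) * \<epsilon>"
      using elim(1) by simp
    also have "\<dots> \<le> \<epsilon> * f\<^sub>1 m 1"
      unfolding f1_1 using elim(1) by (simp add: algebra_simps)
    finally show ?case .
  qed
qed

text \<open>The induction hypothesis has no remainder, so the input is nearly orthonormal with
  \<eta> = 0 and the error bounds of the step become available. The slack in the step then makes the
  new bound free of a remainder as well.\<close>

lemma eventually_gram_defect_Suc: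
  assumes k: "1 \<le> k" "k < n"
    and IH: "\<forall>\<^sub>F \<epsilon> in at_right 0. well_separated \<epsilon> \<longrightarrow> gram_defect k \<epsilon> \<le> \<epsilon> * f\<^sub>1 m k"
  shows "\<forall>\<^sub>F \<epsilon> in at_right 0. well_separated \<epsilon> \<longrightarrow> gram_defect (Suc k) \<epsilon> \<le> \<epsilon> * f\<^sub>1 m (Suc k)"
proof -
  define N where "N = sqrt k * (real m + real k) + 1"
  define f where "f = f\<^sub>1 m k"
  define g where "g = \<gamma>\<^sub>C (Suc k)"
  define g' where "g' = \<gamma>\<^sub>C k"
  have N: "1 \<le> N"
    by (simp add: N_def)
  have f: "0 \<le> f"
    using f1_nonneg[OF k(1)] by (simp add: f_def)
  have gap: "0 < g'\<^sup>2 - g\<^sup>2"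
    using gamma_Suc_sq_less[OF k(1)] by (simp add: g_def g'_def)
  \<comment> \<open>The first entry makes \<tau>, \<tau> N and \<tau> f at most 1/100, since 1, N
    and f are at most f + N; the second is the gap condition of \<open>large_r2\<close>.\<close>
  define \<tau> where "\<tau> = min (1 / (100 * (f + N))) ((g'\<^sup>2 - g\<^sup>2) / 40)"
  have \<tau>0: "0 < \<tau>"
    using f N gap by (simp add: \<tau>_def)
  have \<tau>_le: "\<tau> * x \<le> 1 / 100" if "0 \<le> x" "x \<le> f + N" for x
  proof -
    have "\<tau> * x \<le> 1 / (100 * (f + N)) * (f + N)"
      using that f N by (intro mult_mono) (auto simp: \<tau>_def)
    moreover have "1 / (100 * s) * s = 1 / 100" if "s \<noteq> 0" for s :: real
      using that by simp
    moreover have "f + N \<noteq> 0"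
      using f N by linarith
    ultimately show ?thesis
      by metis
  qed
  have tol: "0 < \<tau>" "\<tau> \<le> 1 / 100" "\<tau> * (sqrt k * (real m + real k) + 1) \<le> 1 / 20" "\<tau> * f \<le> 1 / 20"
    using \<tau>0 \<tau>_le[of 1] \<tau>_le[of N] \<tau>_le[of f] f N by (auto simp flip: N_def)
  have "\<tau> \<le> (g'\<^sup>2 - g\<^sup>2) / 40"
    unfolding \<tau>_def by (rule min.cobounded2)
  then have \<tau>gap: "40 * \<tau> \<le> g'\<^sup>2 - g\<^sup>2"
    by simp
  have pos: "\<forall>\<^sub>F \<epsilon> in at_right (0 :: real). 0 < \<epsilon>"
    by (rule eventually_at_right_less)
  have c: "0 < 1 / (8 :: real)"
    by simp
  have zero: "(\<lambda>_. 0) \<in> O_sq"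
    by simp
  from pos skeleton IH eventually_small_step[OF k zero tol(1-3)]
    eventually_mult_le_at_right_0[OF \<tau>0, of f]
    eventually_mult_le_at_right_0[OF c, of "(real m + 5)\<^sup>2"]
  show ?thesis
  proof eventually_elim
    case (elim \<epsilon>)
    have QA: "Q \<epsilon> \<in> carrier_mat m n"
      using elim(2) by (simp add: cgs2_skeleton_def)
    note vals = cgs2_skeleton_step(2,3)[OF elim(2) k]
    define \<omega> where "\<omega> = \<tau> * min 1 (norm2 (col A k)) * \<epsilon>"
    show ?case
    proof
      assume sep: "well_separated \<epsilon>"
      with elim(3) have defect_le: "gram_defect k \<epsilon> \<le> \<epsilon> * f"
        by (simp add: f_def)
      then have near: "near_orthonormal \<epsilon> 0 (first_cols k (Q \<epsilon>))"
        using elim(5) tol(2) by (simp add: near_orthonormal_iff[OF QA] f_def mult.commute)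
      \<comment> \<open>The defect bound is taken as \<epsilon> f and not just \<tau>, because f has
        to reappear in the coefficient of \<epsilon> for the new column.\<close>
      then interpret small_step m k \<epsilon> \<omega> \<tau> "\<epsilon> * f" "first_cols k (Q \<epsilon>)" "col A k" "v \<epsilon> (Suc k)"
        using elim(4,5) defect_le by (simp add: \<omega>_def mult.commute)
      have N_eq: "local.N = sqrt k * (real m + real k) + 1"
        by (simp add: local.N_def)
      have Suck: "Suc k \<in> {2..n}"
        using k by simp
      have "(0 < r\<^sub>1 \<and> t \<le> g * r\<^sub>2) \<or> 1 / sqrt (1 + g\<^sup>2) \<le> \<bar>r\<^sub>2\<bar>"
      proof -
        have "\<epsilon> * f_sing m (Suc k) * norm2 (col A (Suc k - 1))
              \<le> \<gamma>\<^sub>C (Suc k) * \<bar>R \<epsilon> $$ (Suc k - 1, Suc k - 1)\<bar> \<or>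
            1 / sqrt (1 + (\<gamma>\<^sub>C (Suc k))\<^sup>2) \<le> \<bar>r\<^sub>2\<bar>"
          using sep Suck unfolding well_separated_def by blast
        then have "\<epsilon> * f_sing m (Suc k) * \<beta> \<le> g * \<bar>val_rb (v \<epsilon> (Suc k))\<bar> \<or>
            1 / sqrt (1 + g\<^sup>2) \<le> \<bar>r\<^sub>2\<bar>"
          by (simp only: diff_Suc_1 vals(2) g_def)
        moreover have "f + local.N + 2 + 2 * g \<le> f_sing m (Suc k)"
          using f_sing_Suc[OF k(1), of m] by (simp only: N_eq f_def g_def)
        moreover have "0 < g"
          by (simp add: g_def gamma_pos)
        ultimately show ?thesis
          using large_rb[OF refl f tol(4)] by blast
      qed
      then have t: "t \<le> g' * r\<^sub>2" and r2: "1 / 2 \<le> r\<^sub>2\<^sup>2"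
        using large_r2[of g g'] gamma_pos[of "Suc k"] gamma_Suc_sq_le[OF k(1)] gamma_Suc_le[OF k(1)]
          \<tau>gap by (auto simp: g_def g'_def)
      define L where "L = L\<^sub>F m (Suc k)"
      have L: "real m + 5 \<le> L"
      proof -
        have "1 * 1 \<le> sqrt (real (Suc k)) * (real m + real (Suc k))"
          by (intro mult_mono) auto
        then show ?thesis
          unfolding L_def L\<^sub>F_def by linarith
      qed
      have "norm2 (transpose_mat (first_cols k (Q \<epsilon>)) *\<^sub>v q\<^sub>b) \<le>
          \<epsilon> * (f * g' + sqrt 2 * (local.N + 1 / 2) + 2)"
        by (rule new_column_orthogonal[OF refl f t r2])
      also have "\<dots> \<le> \<epsilon> * ((1 + sqrt 2) * L)"
        using new_column_bound[OF k(1), of m] elim(1)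
        by (intro mult_left_mono) (simp_all only: N_eq f_def g'_def L_def less_imp_le)
      finally have orth: "norm2 (transpose_mat (first_cols k (Q \<epsilon>)) *\<^sub>v q\<^sub>b) \<le> \<epsilon> * ((1 + sqrt 2) * L)" .
      have "\<omega> \<le> \<epsilon> / 4"
      proof -
        have "\<tau> * \<epsilon> \<le> 1 / 4 * \<epsilon>"
          using tol(2) elim(1) by (intro mult_right_mono) auto
        then show ?thesis
          using small_\<omega>(1) by linarith
      qed
      moreover have "r\<^sub>2 \<noteq> 0"
        using r2 by auto
      ultimately have "\<bar>1 - (norm2 q\<^sub>b)\<^sup>2\<bar> \<le> (real m + 5) * \<epsilon>"
        using norm2_normalized_close[OF normalized_y(2) carriers(6,7) elim(1,6)] by blast
      also have "\<dots> \<le> L * \<epsilon>"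
        using L elim(1) by (intro mult_right_mono) auto
      finally have unit: "\<bar>1 - (norm2 q\<^sub>b)\<^sup>2\<bar> \<le> \<epsilon> * L"
        by (simp add: mult.commute)
      have col: "col (first_cols (Suc k) (Q \<epsilon>)) k = q\<^sub>b"
        using col_first_cols[OF QA, of k "Suc k"] k vals(1) by simp
      have "gram_defect (Suc k) \<epsilon> \<le>
          sqrt ((\<epsilon> * f)\<^sup>2 + 2 * (\<epsilon> * ((1 + sqrt 2) * L))\<^sup>2 + (\<epsilon> * L)\<^sup>2)"
        unfolding gram_defect_def
      proof (rule spec_norm_gram_defect_append[OF U])
        show "first_cols (Suc k) (Q \<epsilon>) \<in> carrier_mat m (Suc k)"
          by (rule first_cols_carrier[OF QA])
        show "first_cols (Suc k) (Q \<epsilon>) $$ (i, j) = first_cols k (Q \<epsilon>) $$ (i, j)"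
          if "i < m" "j < k" for i j
          using that QA by (simp add: first_cols_def)
      qed (use defect orth unit in \<open>simp_all add: col\<close>)
      \<comment> \<open>All three block bounds are multiples of \<epsilon>, so \<epsilon> factors
        out and leaves the recurrence for \<open>f\<^sub>1\<close>.\<close>
      also have "\<dots> = sqrt (\<epsilon>\<^sup>2 * (f\<^sup>2 + 2 * ((1 + sqrt 2) * L)\<^sup>2 + L\<^sup>2))"
        by (simp only: power_mult_distrib distrib_left mult.left_commute)
      also have "\<dots> = \<epsilon> * sqrt (f\<^sup>2 + 2 * ((1 + sqrt 2) * L)\<^sup>2 + L\<^sup>2)"
        using elim(1) by (simp add: real_sqrt_mult)
      also have "\<dots> \<le> \<epsilon> * f\<^sub>1 m (Suc k)"
        using f1_Suc[OF k(1), of m] elim(1) by (intro mult_left_mono) (simp_all add: f_def L_def)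
      finally show "gram_defect (Suc k) \<epsilon> \<le> \<epsilon> * f\<^sub>1 m (Suc k)" .
    qed
  qed
qed

lemma eventually_gram_defect:
  assumes "1 \<le> k" "k \<le> n"
  shows "\<forall>\<^sub>F \<epsilon> in at_right 0. well_separated \<epsilon> \<longrightarrow> gram_defect k \<epsilon> \<le> \<epsilon> * f\<^sub>1 m k"
  using assms
proof (induction k rule: dec_induct)
  case base
  show ?case
    using eventually_gram_defect_1 by eventually_elim simp
next
  case (step k)
  then show ?case
    using eventually_gram_defect_Suc[of k] by simp
qed

lemma eventually_orthonormal:
  "\<forall>\<^sub>F \<epsilon> in at_right 0. well_separated \<epsilon> \<longrightarrow>
    spec_norm (1\<^sub>m n - transpose_mat (Q \<epsilon>) * Q \<epsilon>) \<le> \<epsilon> * f\<^sub>1 m n"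
  using eventually_gram_defect[OF n order_refl] skeleton
proof eventually_elim
  case (elim \<epsilon>)
  then have "first_cols n (Q \<epsilon>) = Q \<epsilon>"
    by (intro first_cols_all[of _ m]) (simp add: cgs2_skeleton_def)
  with elim(1) show ?case
    by (simp add: gram_defect_def)
qed

end

theorem mainTheorem3:
  fixes m n :: nat
    and A :: "real mat"
    and Q R :: "real \<Rightarrow> real mat"
    and v :: "real \<Rightarrow> nat \<Rightarrow> cgs2_vals"
  assumes "1 \<le> n" and "n \<le> m"
    and "A \<in> carrier_mat m n"
    and "vec_space.rank m A = n"
    and "cgs2_computes m n A Q R v"
  shows
    "(\<forall>\<eta> \<in> O_sq. \<exists>\<omega> \<in> O_sq. \<forall>\<^sub>F \<epsilon> in at_right 0.
        \<epsilon> * f\<^sub>1 m n < 1 \<longrightarrow>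
        (\<forall>k \<in> {1..n - 1}. near_orthonormal \<epsilon> (\<eta> \<epsilon>) (first_cols k (Q \<epsilon>))) \<longrightarrow>
        spec_norm (A - Q \<epsilon> * R \<epsilon>)
          \<le> \<epsilon> * (2 * real m * sqrt (real n) + 2 * (real n)\<^sup>2 + 13 * sqrt (real n)) * spec_norm A
            + \<omega> \<epsilon>) \<and>
     (\<exists>\<omega> \<in> O_sq. \<forall>\<^sub>F \<epsilon> in at_right 0.
        \<epsilon> * f\<^sub>1 m n < 1 \<longrightarrow>
        (\<forall>k \<in> {2..n}. \<epsilon> * f_sing m k * norm2 (col A (k - 1)) \<le> \<gamma>\<^sub>C k * \<bar>R \<epsilon> $$ (k - 1, k - 1)\<bar>) \<or>
        (\<forall>k \<in> {2..n}. \<bar>val_r2 (v \<epsilon> k)\<bar> \<ge> 1 / sqrt (1 + (\<gamma>\<^sub>C k)\<^sup>2)) \<longrightarrow>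
        spec_norm (1\<^sub>m n - transpose_mat (Q \<epsilon>) * Q \<epsilon>) \<le> \<epsilon> * f\<^sub>1 m n + \<omega> \<epsilon>)"
proof -
  interpret cgs2 m n A Q R v
    using assms by (rule cgs2.intro)
  have zero: "(\<lambda>_. 0) \<in> O_sq"
    by simp
  show ?thesis
  proof (intro conjI ballI)
    fix \<eta> :: "real \<Rightarrow> real" assume \<eta>: "\<eta> \<in> O_sq"
    show "\<exists>\<omega> \<in> O_sq. \<forall>\<^sub>F \<epsilon> in at_right 0.
        \<epsilon> * f\<^sub>1 m n < 1 \<longrightarrow>
        (\<forall>k \<in> {1..n - 1}. near_orthonormal \<epsilon> (\<eta> \<epsilon>) (first_cols k (Q \<epsilon>))) \<longrightarrow>
        spec_norm (A - Q \<epsilon> * R \<epsilon>)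
          \<le> \<epsilon> * (2 * real m * sqrt (real n) + 2 * (real n)\<^sup>2 + 13 * sqrt (real n)) * spec_norm A
            + \<omega> \<epsilon>"
      \<comment> \<open>The remainder is zero: the slack in the first-order coefficient has absorbed
        every second-order term.\<close>
      by (rule bexI[where x = "\<lambda>_. 0"], rule eventually_mono[OF eventually_residual[OF \<eta>]])
        (simp_all add: zero)
  next
    show "\<exists>\<omega> \<in> O_sq. \<forall>\<^sub>F \<epsilon> in at_right 0.
        \<epsilon> * f\<^sub>1 m n < 1 \<longrightarrow>
        (\<forall>k \<in> {2..n}. \<epsilon> * f_sing m k * norm2 (col A (k - 1)) \<le> \<gamma>\<^sub>C k * \<bar>R \<epsilon> $$ (k - 1, k - 1)\<bar>) \<or>
        (\<forall>k \<in> {2..n}. \<bar>val_r2 (v \<epsilon> k)\<bar> \<ge> 1 / sqrt (1 + (\<gamma>\<^sub>C k)\<^sup>2)) \<longrightarrow>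
        spec_norm (1\<^sub>m n - transpose_mat (Q \<epsilon>) * Q \<epsilon>) \<le> \<epsilon> * f\<^sub>1 m n + \<omega> \<epsilon>"
      by (rule bexI[where x = "\<lambda>_. 0"], rule eventually_mono[OF eventually_orthonormal])
        (simp_all add: zero well_separated_def)
  qed
qed

end
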